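(* Let $\Omega_0$ and $\Omega$ be closed and open sets, respectively, of the complex plane, with $\Omega_0\subset\Omega\subset\mathbb{C}$. Let $f(z)$ be an analytic function on $\Omega\setminus\Omega_0$, and let $z_1\in\Omega_0$ and $z_2\in\Omega\setminus\Omega_0$. Then, for $z\in\Omega\setminus\Omega_0$, $f(z)$ admits the Taylor-Laurent expansion $$f(z)=\sum_{n=0}^{N-1}\left[d_n(z_1,z_2)(z-z_1)+d_n(z_2,z_1)(z-z_2)\right](z-z_1)^n(z-z_2)^n+\sum_{n=0}^{N-1}e_n(z_1,z_2)(z-z_2)^n(z-z_1)^{-n-1}+r_N(z_1,z_2;z),$$ where the coefficients $d_n(z_1,z_2)$, $d_n(z_2,z_1)$ and $e_n(z_1,z_2)$ are given by the Cauchy integrals $$d_n(z_1,z_2)=\frac{1}{2\pi i(z_2-z_1)}\int_{\Gamma_1}\frac{f(w)\,dw}{(w-z_1)^n(w-z_2)^{n+1}}$$ (with $z_1$ and $z_2$ interchanged in this formula for $d_n(z_2,z_1)$, the contour $\Gamma_1$ being unchanged) and $$e_n(z_1,z_2)=\frac{z_1-z_2}{2\pi i}\int_{\Gamma_2}\frac{(w-z_1)^n}{(w-z_2)^{n+1}}f(w)\,dw.$$ The remainder term $r_N(z_1,z_2;z)$ is given by the Cauchy integrals $$r_N(z_1,z_2;z)=\frac{1}{2\pi i}\int_{\Gamma_1}\frac{f(w)\,dw}{(w-z_1)^N(w-z_2)^N(w-z)}(z-z_1)^N(z-z_2)^N-\frac{1}{2\pi i}\int_{\Gamma_2}\frac{(w-z_1)^Nf(w)\,dw}{(w-z_2)^N(w-z)}\,\frac{(z-z_2)^N}{(z-z_1)^N}.$$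 In these integrals, the contours of integration $\Gamma_1$ and $\Gamma_2$ are simple closed loops contained in $\Omega\setminus\Omega_0$ which encircle $\Omega_0$ in the counterclockwise direction. Moreover, $\Gamma_2$ does not contain the points $z$ and $z_2$ inside, whereas $\Gamma_1$ encircles $\Gamma_2$ and the points $z$ and $z_2$. The expansion is convergent in the region $$D_{z_1,z_2}=\{z\in\Omega\setminus\Omega_0:\ |(z-z_1)(z-z_2)|<r_1\ \text{ and }\ |z-z_2|<r_2|z-z_1|\},$$ where $$r_1=\inf_{w\in\mathbb{C}\setminus\Omega}|(w-z_1)(w-z_2)|,\qquad r_2=\inf_{w\in\Omega_0}\left|(w-z_2)(w-z_1)^{-1}\right|.$$
   Context: $N$ is a positive integer. Convergence of the expansion means that $r_N(z_1,z_2;z)\to0$ as $N\to\infty$. The infimum of the empty set is $+\infty$, and $|(w-z_2)(w-z_1)^{-1}|$ is read as $+\infty$ at $w=z_1$.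
   Formalization: The interior of Γ₁ is additionally required to lie in Ω (otherwise false: Ω=ℂ∖{5}, Ω₀={0}, f=1/(w−5), Γ₁ a large circle, Γ₂ a small one), and z, z₂ are taken strictly outside Γ₂, not on it. *)

theory Defs
  imports "HOL-Complex_Analysis.Complex_Analysis"
begin

definition ccw_loop :: "(real \<Rightarrow> complex) \<Rightarrow> bool" where
  "ccw_loop \<gamma> \<longleftrightarrow>
     valid_path \<gamma> \<and> simple_path \<gamma> \<and> pathfinish \<gamma> = pathstart \<gamma> \<and>
     (\<forall>w \<in> inside (path_image \<gamma>). winding_number \<gamma> w = 1)"

(* "Encircles" is membership in the bounded side of the Jordan curve. The points z and z2 are
   required to be off Gamma2 as well as not inside it, because the integrands are singular there.
   The condition that the inside of Gamma1 lies in Omega is the usual tacit one: f has no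
   singularities inside Gamma1 other than those in Omega0. Without it the expansion already fails
   for Omega = C - {5}, Omega0 = {0}, f(w) = 1/(w - 5) and Gamma1 a large circle. *)
definition admissible_contours ::
  "complex set \<Rightarrow> complex set \<Rightarrow> complex \<Rightarrow> complex \<Rightarrow> (real \<Rightarrow> complex) \<Rightarrow> (real \<Rightarrow> complex) \<Rightarrow> bool"
where
  "admissible_contours \<Omega> \<Omega>\<^sub>0 z\<^sub>2 z \<Gamma>\<^sub>1 \<Gamma>\<^sub>2 \<longleftrightarrow>
     ccw_loop \<Gamma>\<^sub>1 \<and> path_image \<Gamma>\<^sub>1 \<subseteq> \<Omega> - \<Omega>\<^sub>0 \<and> \<Omega>\<^sub>0 \<subseteq> inside (path_image \<Gamma>\<^sub>1) \<and>
     ccw_loop \<Gamma>\<^sub>2 \<and> path_image \<Gamma>\<^sub>2 \<subseteq> \<Omega> - \<Omega>\<^sub>0 \<and> \<Omega>\<^sub>0 \<subseteq> inside (path_image \<Gamma>\<^sub>2) \<and>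
     {z, z\<^sub>2} \<subseteq> outside (path_image \<Gamma>\<^sub>2) \<and>
     path_image \<Gamma>\<^sub>2 \<union> {z, z\<^sub>2} \<subseteq> inside (path_image \<Gamma>\<^sub>1) \<and>
     inside (path_image \<Gamma>\<^sub>1) \<subseteq> \<Omega>"

definition coeff_d ::
  "(complex \<Rightarrow> complex) \<Rightarrow> (real \<Rightarrow> complex) \<Rightarrow> nat \<Rightarrow> complex \<Rightarrow> complex \<Rightarrow> complex"
where
  "coeff_d f \<Gamma>\<^sub>1 n z\<^sub>1 z\<^sub>2 =
     1 / (2 * of_real pi * \<i> * (z\<^sub>2 - z\<^sub>1)) *
     contour_integral \<Gamma>\<^sub>1 (\<lambda>w. f w / ((w - z\<^sub>1) ^ n * (w - z\<^sub>2) ^ (n + 1)))"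

definition coeff_e ::
  "(complex \<Rightarrow> complex) \<Rightarrow> (real \<Rightarrow> complex) \<Rightarrow> nat \<Rightarrow> complex \<Rightarrow> complex \<Rightarrow> complex"
where
  "coeff_e f \<Gamma>\<^sub>2 n z\<^sub>1 z\<^sub>2 =
     (z\<^sub>1 - z\<^sub>2) / (2 * of_real pi * \<i>) *
     contour_integral \<Gamma>\<^sub>2 (\<lambda>w. (w - z\<^sub>1) ^ n / (w - z\<^sub>2) ^ (n + 1) * f w)"

definition remainder ::
  "(complex \<Rightarrow> complex) \<Rightarrow> (real \<Rightarrow> complex) \<Rightarrow> (real \<Rightarrow> complex) \<Rightarrow> nat
     \<Rightarrow> complex \<Rightarrow> complex \<Rightarrow> complex \<Rightarrow> complex"
where
  "remainder f \<Gamma>\<^sub>1 \<Gamma>\<^sub>2 N z\<^sub>1 z\<^sub>2 z =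
     1 / (2 * of_real pi * \<i>) *
       contour_integral \<Gamma>\<^sub>1 (\<lambda>w. f w / ((w - z\<^sub>1) ^ N * (w - z\<^sub>2) ^ N * (w - z))) *
       ((z - z\<^sub>1) ^ N * (z - z\<^sub>2) ^ N) -
     1 / (2 * of_real pi * \<i>) *
       contour_integral \<Gamma>\<^sub>2 (\<lambda>w. (w - z\<^sub>1) ^ N * f w / ((w - z\<^sub>2) ^ N * (w - z))) *
       ((z - z\<^sub>2) ^ N / (z - z\<^sub>1) ^ N)"

(* Extended reals, so that an infimum over the empty set is infinity. *)
definition radius1 :: "complex set \<Rightarrow> complex \<Rightarrow> complex \<Rightarrow> ereal" where
  "radius1 \<Omega> z\<^sub>1 z\<^sub>2 = (INF w \<in> UNIV - \<Omega>. ereal (cmod ((w - z\<^sub>1) * (w - z\<^sub>2))))"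

definition radius2 :: "complex set \<Rightarrow> complex \<Rightarrow> complex \<Rightarrow> ereal" where
  "radius2 \<Omega>\<^sub>0 z\<^sub>1 z\<^sub>2 =
     (INF w \<in> \<Omega>\<^sub>0. if w = z\<^sub>1 then \<infinity> else ereal (cmod ((w - z\<^sub>2) * inverse (w - z\<^sub>1))))"

definition region_D ::
  "complex set \<Rightarrow> complex set \<Rightarrow> complex \<Rightarrow> complex \<Rightarrow> complex set"
where
  "region_D \<Omega> \<Omega>\<^sub>0 z\<^sub>1 z\<^sub>2 =
     {z \<in> \<Omega> - \<Omega>\<^sub>0. ereal (cmod ((z - z\<^sub>1) * (z - z\<^sub>2))) < radius1 \<Omega> z\<^sub>1 z\<^sub>2 \<and>
        ereal (cmod (z - z\<^sub>2)) < radius2 \<Omega>\<^sub>0 z\<^sub>1 z\<^sub>2 * ereal (cmod (z - z\<^sub>1))}"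

end

theory Submission
  imports Defs
begin

text \<open>
  Write \<open>B w = (w - z\<^sub>1) * (w - z\<^sub>2)\<close> and \<open>p w = (w - z\<^sub>2) / (w - z\<^sub>1)\<close>.

  The expansion itself is Cauchy's formula for the region between the two contours
  (\<open>Cauchy_integral_formula_annulus\<close>) with the kernel \<open>1 / (w - z)\<close> expanded in powers of
  \<open>B z / B w\<close> on the outer contour and of \<open>p z / p w\<close> on the inner one. Both are finite geometric
  sums: the remainder for \<open>n\<close> and for \<open>n + 1\<close> differ by the \<open>n\<close>-th term of the series
  (\<open>outer_step\<close>, \<open>inner_step\<close>), and the remainder for \<open>0\<close> is Cauchy's formula.

  Convergence cannot be read off from the given contours, because \<open>\<bar>B z\<bar> < \<bar>B w\<bar>\<close> and
  \<open>\<bar>p z\<bar> < \<bar>p w\<bar>\<close> may fail on them. Rather than deforming them, write \<open>f = f\<^sub>1 + f\<^sub>2\<close>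
  with \<open>f\<^sub>1\<close> holomorphic on all of \<open>\<Omega>\<close> and \<open>f\<^sub>2\<close> holomorphic off \<open>\<Omega>\<^sub>0\<close> and of order \<open>1 / w\<close> at
  infinity (\<open>Laurent_split\<close>). Each part of the remainder then sees only one of the two summands,
  and is evaluated in closed form.

  \<^item> On the lemniscate region \<open>\<bar>B w\<bar> < \<rho>\<close>, which lies in \<open>\<Omega>\<close> when \<open>\<rho> \<le> r\<^sub>1\<close>, one has
    \<open>f\<^sub>1 w = g (B w) + (w - m) * h (B w)\<close> with \<open>m\<close> the midpoint of \<open>z\<^sub>1\<close> and \<open>z\<^sub>2\<close> and with \<open>g\<close>, \<open>h\<close>
    holomorphic on the disc of radius \<open>\<rho>\<close> (\<open>lemniscate_decomposition\<close>). If \<open>Q\<close> arises by cutting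
    the Taylor series of \<open>g\<close> and \<open>h\<close> after \<open>N\<close> terms, then \<open>f\<^sub>1 = Q + B ^ N * H\<close> with \<open>H\<close>
    holomorphic on \<open>\<Omega>\<close>, and the outer part of the remainder is \<open>B z ^ N * H z = f\<^sub>1 z - Q z\<close>:
    \<open>H\<close> contributes by Cauchy's formula, while \<open>Q\<close> and \<open>f\<^sub>2\<close> contribute nothing since their
    integrands decay fast enough at infinity.

  \<^item> The region \<open>\<bar>p w\<bar> < \<sigma>\<close> avoids \<open>\<Omega>\<^sub>0\<close> when \<open>\<sigma> \<le> r\<^sub>2\<close>, and there
    \<open>(w - z\<^sub>1) * f\<^sub>2 w = \<psi> (p w)\<close> with \<open>\<psi>\<close> holomorphic on the disc of radius \<open>\<sigma>\<close>
    (\<open>exterior_quotient_expansion\<close>). By the same argument, with inside and outside exchanged, the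
    inner part of the remainder is, up to sign, the Taylor tail of \<open>\<psi>\<close> at \<open>p z\<close>, divided by
    \<open>z - z\<^sub>1\<close>.

  Both tails tend to \<open>0\<close> because \<open>\<bar>B z\<bar> < \<rho>\<close> and \<open>\<bar>p z\<bar> < \<sigma>\<close> for suitable \<open>\<rho>\<close> and \<open>\<sigma>\<close> when \<open>z\<close> lies
  in the region of convergence.
\<close>

section \<open>Cauchy's theorem between two nested loops\<close>

lemma ccw_loopD:
  assumes "ccw_loop \<gamma>"
  shows "valid_path \<gamma>" and "path \<gamma>" and "pathfinish \<gamma> = pathstart \<gamma>"
    and "compact (path_image \<gamma>)" and "connected (path_image \<gamma>)"
    and "open (inside (path_image \<gamma>))" and "open (outside (path_image \<gamma>))"
    and "\<And>w. w \<in> inside (path_image \<gamma>) \<Longrightarrow> winding_number \<gamma> w = 1"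
    and "\<And>w. w \<in> outside (path_image \<gamma>) \<Longrightarrow> winding_number \<gamma> w = 0"
proof -
  show v: "valid_path \<gamma>" "pathfinish \<gamma> = pathstart \<gamma>"
    and "\<And>w. w \<in> inside (path_image \<gamma>) \<Longrightarrow> winding_number \<gamma> w = 1"
    using assms by (auto simp: ccw_loop_def)
  show p: "path \<gamma>" using v by (simp add: valid_path_imp_path)
  show c: "compact (path_image \<gamma>)" "connected (path_image \<gamma>)"
    using p by (auto simp: compact_path_image connected_path_image)
  show "open (inside (path_image \<gamma>))" "open (outside (path_image \<gamma>))"
    using c by (auto intro!: open_inside open_outside compact_imp_closed)
  show "\<And>w. w \<in> outside (path_image \<gamma>) \<Longrightarrow> winding_number \<gamma> w = 0"
    using p v winding_number_zero_in_outside by blast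
qed

text \<open>
  The complement of the inside of \<open>g\<close> is connected and unbounded and does not meet \<open>h\<close>, so it lies
  in a single unbounded component of the complement of \<open>h\<close>.
\<close>

lemma complement_inside_subset_outside:
  assumes "ccw_loop g" and "path_image h \<subseteq> inside (path_image g)"
  shows "- inside (path_image g) \<subseteq> outside (path_image h)"
proof
  fix w assume w: "w \<in> - inside (path_image g)"
  let ?T = "path_image g \<union> outside (path_image g)"
  have T: "?T = - inside (path_image g)" by (rule union_with_outside)
  have "connected ?T"
    using ccw_loopD[OF assms(1)] by (intro connected_with_outside) (auto intro: compact_imp_closed)
  moreover have "?T \<subseteq> - path_image h" using assms(2) T by auto
  ultimately have "?T \<subseteq> connected_component_set (- path_image h) w"
    using w T by (intro connected_component_maximal) auto
  moreover have "\<not> bounded ?T"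
    using unbounded_outside[of "path_image g"] ccw_loopD(4)[OF assms(1)]
    by (meson bounded_subset compact_imp_bounded sup_ge2)
  ultimately have "\<not> bounded (connected_component_set (- path_image h) w)"
    using bounded_subset by blast
  then show "w \<in> outside (path_image h)" using w T unfolding outside by simp
qed

text \<open>
  Running along \<open>g\<close>, over the segment, backwards along \<open>h\<close>, and back over the segment gives one
  closed path with winding number \<open>0\<close> around every point off \<open>S\<close>; the two passages of the segment
  cancel in the integral. This turns a statement on two loops into the homology form of Cauchy's
  theorem for one.
\<close>

lemma linked_loops_contour_integral_eq:
  assumes g: "valid_path g" "pathfinish g = pathstart g" "path_image g \<subseteq> S"
    and h: "valid_path h" "pathfinish h = pathstart h" "path_image h \<subseteq> S"
    and S: "open S" and f: "f holomorphic_on S"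
    and a: "a \<in> path_image g" and b: "b \<in> path_image h" and seg: "closed_segment a b \<subseteq> S"
    and wind: "\<And>w. w \<notin> S \<Longrightarrow> winding_number g w = winding_number h w"
  shows "contour_integral g f = contour_integral h f"
proof -
  obtain s where s: "s \<in> {0..1}" "g s = a" using a by (auto simp: path_image_def)
  obtain t where t: "t \<in> {0..1}" "h t = b" using b by (auto simp: path_image_def)
  define g' where "g' = shiftpath s g"
  define h' where "h' = reversepath (shiftpath t h)"
  have g': "valid_path g'" "pathstart g' = a" "pathfinish g' = a" "path_image g' = path_image g"
    using g s by (auto simp: g'_def pathstart_shiftpath pathfinish_shiftpath path_image_shiftpath valid_path_shiftpath)
  have vt: "valid_path (shiftpath t h)" using h t by (auto simp: valid_path_shiftpath)
  have h': "valid_path h'" "pathstart h' = b" "pathfinish h' = b" "path_image h' = path_image h"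
    using h t vt by (auto simp: h'_def pathstart_shiftpath pathfinish_shiftpath path_image_shiftpath)
  define \<gamma> where "\<gamma> = g' +++ (linepath a b +++ (h' +++ linepath b a))"
  have v\<gamma>: "valid_path \<gamma>" "pathfinish \<gamma> = pathstart \<gamma>"
    using g' h' by (auto simp: \<gamma>_def intro!: valid_path_join)
  have im: "path_image \<gamma> \<subseteq> S"
    using g' h' g h seg by (auto simp: \<gamma>_def path_image_join closed_segment_commute[of b a])
  have wind0: "winding_number \<gamma> w = 0" if "w \<notin> S" for w
  proof -
    have nin: "w \<notin> path_image g" "w \<notin> path_image h" "w \<notin> closed_segment a b" "w \<notin> closed_segment b a"
      using that g h seg by (auto simp: closed_segment_commute[of b a])
    have "winding_number g' w = winding_number g w"
      unfolding g'_def using g nin s by (intro winding_number_shiftpath) (auto simp: valid_path_imp_path)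
    moreover have "winding_number h' w = - winding_number h w"
      unfolding h'_def using h nin t vt
      by (simp add: winding_number_reversepath winding_number_shiftpath valid_path_imp_path path_image_shiftpath)
    moreover have "winding_number (linepath b a) w = - winding_number (linepath a b) w"
      using winding_number_reversepath[of "linepath a b" w] nin by simp
    moreover have "winding_number \<gamma> w = winding_number g' w + (winding_number (linepath a b) w
        + (winding_number h' w + winding_number (linepath b a) w))"
      unfolding \<gamma>_def using g' h' nin
      by (simp add: winding_number_join valid_path_imp_path path_image_join)
    ultimately show ?thesis using wind[OF that] by simp
  qed
  have int: "f contour_integrable_on p" if "valid_path p" "path_image p \<subseteq> S" for p
    using contour_integrable_holomorphic_simple f S that by blast
  have "contour_integral \<gamma> f = 0"
    using Cauchy_theorem_global[OF S f v\<gamma> im wind0] by (rule contour_integral_unique)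
  moreover have "contour_integral \<gamma> f = contour_integral g' f + (contour_integral (linepath a b) f
      + (contour_integral h' f + contour_integral (linepath b a) f))"
    unfolding \<gamma>_def using g' h' g h seg
    by (simp add: int valid_path_join path_image_join closed_segment_commute[of b a])
  moreover have "contour_integral (linepath b a) f = - contour_integral (linepath a b) f"
    using contour_integral_reversepath[of "linepath a b" f] by simp
  moreover have "contour_integral g' f = contour_integral g f"
    unfolding g'_def using g s by (intro contour_integral_shiftpath) auto
  moreover have "contour_integral h' f = - contour_integral h f"
    unfolding h'_def using h t vt by (simp add: contour_integral_reversepath contour_integral_shiftpath)
  ultimately show ?thesis by (simp add: algebra_simps)
qed

text \<open>
  A segment of minimal length between the two loops meets neither of them in its interior. Near its
  one end it is inside \<open>g\<close> and near the other it is outside \<open>h\<close>, hence so it is throughout, and it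
  links the loops within \<open>S\<close>.
\<close>

theorem nested_loops_contour_integral_eq:
  assumes g: "ccw_loop g" and h: "ccw_loop h"
    and nest: "path_image h \<subseteq> inside (path_image g)"
    and S: "open S" "path_image g \<subseteq> S" "path_image h \<subseteq> S"
      "inside (path_image g) \<inter> outside (path_image h) \<subseteq> S"
    and f: "f holomorphic_on S"
  shows "contour_integral g f = contour_integral h f"
proof -
  note G = ccw_loopD[OF g] and H = ccw_loopD[OF h]
  have out: "- inside (path_image g) \<subseteq> outside (path_image h)"
    by (rule complement_inside_subset_outside[OF g nest])
  obtain a b where ab: "a \<in> path_image g" "b \<in> path_image h"
      "dist a b = setdist (path_image g) (path_image h)"
    using setdist_compact_closed[of "path_image g" "path_image h"] G H
    by (auto intro: compact_imp_closed)
  have min: "dist a b \<le> dist x y" if "x \<in> path_image g" "y \<in> path_image h" for x y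
    using that setdist_le_dist[of x "path_image g" y "path_image h"] ab by simp
  have anb: "a \<noteq> b" using ab nest inside_no_overlap by fastforce
  let ?I = "open_segment a b"
  have off: "?I \<inter> path_image g = {}" "?I \<inter> path_image h = {}"
    using min ab dist_in_open_segment[of _ a b] by (fastforce simp: dist_commute)+
  have con: "connected ?I" by (intro convex_connected convex_open_segment)
  have "a \<in> closure ?I" "b \<in> closure ?I" using anb by (auto simp: closure_open_segment)
  moreover have "b \<in> inside (path_image g)" using ab nest by auto
  moreover have "a \<in> outside (path_image h)" using ab out inside_no_overlap by blast
  ultimately have meet: "?I \<inter> inside (path_image g) \<noteq> {}" "?I \<inter> outside (path_image h) \<noteq> {}"
    using G H by (metis disjoint_iff open_Int_closure_eq_empty)+
  have seg_split: "?I \<subseteq> A"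
    if "?I \<inter> A \<noteq> {}" "?I \<subseteq> A \<union> B" "open A" "open B" "A \<inter> B = {}" for A B
    using connectedD[OF con that(3,4)] that by blast
  have "?I \<subseteq> inside (path_image g)"
    using seg_split[of "inside (path_image g)" "outside (path_image g)"] meet off G inside_Un_outside[of "path_image g"] by auto
  moreover have "?I \<subseteq> outside (path_image h)"
    using seg_split[of "outside (path_image h)" "inside (path_image h)"] meet off(2) H(6,7)
      inside_Un_outside[of "path_image h"] inside_Int_outside[of "path_image h"] by blast
  ultimately have "closed_segment a b \<subseteq> S"
    using S ab by (auto simp: closed_segment_eq_open)
  moreover have "winding_number g w = winding_number h w" if w: "w \<notin> S" for w
  proof (cases "w \<in> inside (path_image g)")
    case True
    then have "w \<in> inside (path_image h)"
      using w S inside_Un_outside[of "path_image h"] by blast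
    then show ?thesis using True G(8) H(8) by simp
  next
    case False
    then have "w \<in> outside (path_image g)"
      using w S inside_Un_outside[of "path_image g"] by blast
    moreover have "w \<in> outside (path_image h)" using False out by blast
    ultimately show ?thesis using G(9) H(9) by simp
  qed
  ultimately show ?thesis
    using linked_loops_contour_integral_eq[OF G(1,3) S(2) H(1,3) S(3,1) f ab(1,2)] by blast
qed

section \<open>Integrals determined at infinity\<close>

lemma filterlim_diff_const_at_infinity:
  fixes a :: complex
  shows "filterlim (\<lambda>w. w - a) at_infinity at_infinity"
  using tendsto_add_filterlim_at_infinity[of "\<lambda>_. - a" "- a" at_infinity "\<lambda>w. w"]
  by (simp add: filterlim_ident)

lemma tendsto_inverse_diff_at_infinity:
  fixes a :: complex
  shows "((\<lambda>w. 1 / (w - a)) \<longlongrightarrow> 0) at_infinity"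
  by (rule tendsto_divide_0[OF tendsto_const filterlim_diff_const_at_infinity])

lemma tendsto_quotient_diff_at_infinity:
  fixes a b :: complex
  shows "((\<lambda>w. (w - b) / (w - a)) \<longlongrightarrow> 1) at_infinity"
proof -
  have "((\<lambda>w. 1 + (a - b) * (1 / (w - a))) \<longlongrightarrow> 1 + (a - b) * 0) at_infinity"
    by (intro tendsto_intros tendsto_inverse_diff_at_infinity)
  moreover have "eventually (\<lambda>w. 1 + (a - b) * (1 / (w - a)) = (w - b) / (w - a)) at_infinity"
    by (rule eventually_mono[OF eventually_not_equal_at_infinity[of a]]) (simp add: field_simps)
  ultimately show ?thesis
    by (simp add: tendsto_cong)
qed

lemma ccw_loop_circlepath:
  assumes "R > 0" shows "ccw_loop (circlepath a R)"
    and "inside (path_image (circlepath a R)) = ball a R"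
proof -
  show *: "inside (path_image (circlepath a R)) = ball a R"
    using inside_frontier_eq_interior[of "cball a R"] assms by simp
  show "ccw_loop (circlepath a R)"
    unfolding ccw_loop_def * using assms
    by (auto simp: simple_path_circlepath dist_norm norm_minus_commute intro!: winding_number_circlepath)
qed

text \<open>
  The residue at infinity: the loop may be replaced by a large circle, on which \<open>f w\<close> is close to
  \<open>c / w\<close>.
\<close>

lemma contour_integral_limit_at_infinity:
  assumes \<gamma>: "ccw_loop \<gamma>" and S: "open S" "path_image \<gamma> \<union> outside (path_image \<gamma>) \<subseteq> S"
    and f: "f holomorphic_on S" and lim: "((\<lambda>w. w * f w) \<longlongrightarrow> c) at_infinity"
  shows "contour_integral \<gamma> f = 2 * of_real pi * \<i> * c"
proof -
  note G = ccw_loopD[OF \<gamma>]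
  obtain r where r: "path_image \<gamma> \<subseteq> ball 0 r"
    using bounded_subset_ballD[OF compact_imp_bounded[OF G(4)]] by blast
  have "cmod (contour_integral \<gamma> f - 2 * of_real pi * \<i> * c) \<le> 0 + \<epsilon>" if "\<epsilon> > 0" for \<epsilon>
  proof -
    define e where "e = \<epsilon> / (2 * pi)"
    have e: "e > 0" using that by (simp add: e_def)
    obtain R0 where R0: "\<And>w. cmod w \<ge> R0 \<Longrightarrow> dist (w * f w) c < e"
      using lim e unfolding Lim_at_infinity by blast
    define R where "R = max 1 (max r R0)"
    have R: "R > 0" "R \<ge> r" "R \<ge> R0" by (auto simp: R_def)
    note C = ccw_loop_circlepath[OF R(1), of 0]
    have nest: "path_image \<gamma> \<subseteq> inside (path_image (circlepath 0 R))"
      using r R C by auto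
    have sph: "path_image (circlepath 0 R) \<subseteq> outside (path_image \<gamma>)"
      using complement_inside_subset_outside[OF C(1) nest] inside_no_overlap by blast
    have eq: "contour_integral (circlepath 0 R) f = contour_integral \<gamma> f"
      by (rule nested_loops_contour_integral_eq[OF C(1) \<gamma> nest S(1) _ _ _ f]) (use S sph in auto)
    have "(f has_contour_integral contour_integral \<gamma> f) (circlepath 0 R)"
      unfolding eq[symmetric] using S sph R
      by (intro has_contour_integral_integral contour_integrable_holomorphic_simple[OF f]) auto
    moreover have "((\<lambda>w. c * (1 / (w - 0))) has_contour_integral c * (2 * of_real pi * \<i>)) (circlepath 0 R)"
      using has_contour_integral_winding_number[of "circlepath 0 R" 0] R winding_number_circlepath[of 0 0 R]
      by (intro has_contour_integral_lmul) auto
    ultimately have "((\<lambda>w. f w - c * (1 / (w - 0))) has_contour_integral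
        contour_integral \<gamma> f - c * (2 * of_real pi * \<i>)) (circlepath 0 R)"
      by (rule has_contour_integral_diff)
    then have "cmod (contour_integral \<gamma> f - c * (2 * of_real pi * \<i>)) \<le> (e / R) * (2 * pi * R)"
    proof (rule has_contour_integral_bound_circlepath)
      fix w :: complex assume "cmod (w - 0) = R"
      then have w: "cmod w = R" "w \<noteq> 0" using R by auto
      then have "f w - c * (1 / (w - 0)) = (w * f w - c) / w" by (simp add: field_simps)
      then show "cmod (f w - c * (1 / (w - 0))) \<le> e / R"
        using R0[of w] w R by (simp add: norm_divide dist_norm divide_right_mono)
    qed (use e R in auto)
    also have "\<dots> = \<epsilon>" using R by (simp add: e_def)
    finally show ?thesis by (simp add: mult.commute)
  qed
  then have "cmod (contour_integral \<gamma> f - 2 * of_real pi * \<i> * c) \<le> 0" by (rule field_le_epsilon)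
  then show ?thesis by simp
qed

text \<open>
  Cauchy's formulas for \<open>f\<close> at \<open>z\<close> are Cauchy's theorem for the difference quotient, whose
  singularity at \<open>z\<close> is removable; this lemma translates between the two.
\<close>

lemma contour_integral_difference_quotient:
  assumes "valid_path \<gamma>" "open S" "f holomorphic_on S" "path_image \<gamma> \<subseteq> S" "z \<notin> path_image \<gamma>"
  shows "contour_integral \<gamma> (\<lambda>w. if w = z then deriv f z else (f w - f z) / (w - z)) =
    contour_integral \<gamma> (\<lambda>w. f w / (w - z)) - 2 * of_real pi * \<i> * winding_number \<gamma> z * f z"
proof -
  have "(\<lambda>w. f w / (w - z)) contour_integrable_on \<gamma>"
    by (rule contour_integrable_holomorphic_simple[of _ "S - {z}"])
       (use assms in \<open>auto intro!: holomorphic_intros intro: holomorphic_on_subset\<close>)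
  moreover have "((\<lambda>w. f z * (1 / (w - z))) has_contour_integral
      f z * (2 * of_real pi * \<i> * winding_number \<gamma> z)) \<gamma>"
    using has_contour_integral_winding_number[of \<gamma> z] assms by (intro has_contour_integral_lmul) simp
  ultimately have "((\<lambda>w. f w / (w - z) - f z * (1 / (w - z))) has_contour_integral
     contour_integral \<gamma> (\<lambda>w. f w / (w - z)) - f z * (2 * of_real pi * \<i> * winding_number \<gamma> z)) \<gamma>"
    by (intro has_contour_integral_diff has_contour_integral_integral)
  then have "((\<lambda>w. if w = z then deriv f z else (f w - f z) / (w - z)) has_contour_integral
     contour_integral \<gamma> (\<lambda>w. f w / (w - z)) - f z * (2 * of_real pi * \<i> * winding_number \<gamma> z)) \<gamma>"
    by (rule has_contour_integral_eq) (use assms in \<open>auto simp: diff_divide_distrib\<close>)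
  then show ?thesis by (auto dest: contour_integral_unique simp: mult_ac)
qed

theorem Cauchy_integral_formula_annulus:
  assumes g: "ccw_loop g" and h: "ccw_loop h"
    and nest: "path_image h \<subseteq> inside (path_image g)"
    and S: "open S" "path_image g \<subseteq> S" "path_image h \<subseteq> S"
      "inside (path_image g) \<inter> outside (path_image h) \<subseteq> S"
    and f: "f holomorphic_on S"
    and z: "z \<in> inside (path_image g)" "z \<in> outside (path_image h)"
  shows "contour_integral g (\<lambda>w. f w / (w - z)) - contour_integral h (\<lambda>w. f w / (w - z)) =
    2 * of_real pi * \<i> * f z"
proof -
  note G = ccw_loopD[OF g] and H = ccw_loopD[OF h]
  have "z \<notin> path_image g" "z \<notin> path_image h"
    using z inside_no_overlap outside_no_overlap by blast+
  then show ?thesis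
    using nested_loops_contour_integral_eq[OF g h nest S pole_lemma_open[OF f S(1)], of z] G H z
      contour_integral_difference_quotient[OF _ S(1) f] S
    by (simp add: algebra_simps)
qed

text \<open>
  For the difference quotient \<open>F\<close> of \<open>f\<close> at \<open>z\<close>, \<open>w * F w\<close> tends to \<open>- f z\<close> at infinity, and the
  winding number around \<open>z\<close> is \<open>0\<close>.
\<close>

lemma Cauchy_integral_formula_exterior:
  assumes \<gamma>: "ccw_loop \<gamma>" and S: "open S" "path_image \<gamma> \<union> outside (path_image \<gamma>) \<subseteq> S"
    and f: "f holomorphic_on S" and lim: "(f \<longlongrightarrow> 0) at_infinity"
    and z: "z \<in> outside (path_image \<gamma>)"
  shows "contour_integral \<gamma> (\<lambda>w. f w / (w - z)) = - (2 * of_real pi * \<i> * f z)"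
proof -
  have "((\<lambda>w. (w - 0) / (w - z) * (f w - f z)) \<longlongrightarrow> 1 * (0 - f z)) at_infinity"
    by (intro tendsto_intros tendsto_quotient_diff_at_infinity lim)
  moreover have "eventually (\<lambda>w. (w - 0) / (w - z) * (f w - f z) =
      w * (if w = z then deriv f z else (f w - f z) / (w - z))) at_infinity"
    by (rule eventually_mono[OF eventually_not_equal_at_infinity[of z]]) simp
  ultimately have "((\<lambda>w. w * (if w = z then deriv f z else (f w - f z) / (w - z))) \<longlongrightarrow> - f z) at_infinity"
    by (simp add: tendsto_cong)
  note contour_integral_limit_at_infinity[OF \<gamma> S pole_lemma_open[OF f S(1)] this]
  moreover have "z \<notin> path_image \<gamma>" using z outside_no_overlap[of "path_image \<gamma>"] by blast
  ultimately show ?thesis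
    using contour_integral_difference_quotient[of \<gamma> S f z] ccw_loopD(1)[OF \<gamma>]
      ccw_loopD(9)[OF \<gamma> z] S f by auto
qed

section \<open>Cauchy transforms\<close>

text \<open>
  A bound for the integral of \<open>f * h\<close> in terms of \<open>h\<close> alone. The neighbourhood \<open>V\<close> is chosen such
  that \<open>f\<close> is bounded on it. In the next two lemmas \<open>h\<close> depends on a parameter and tends to \<open>0\<close>
  uniformly on \<open>V\<close>, which justifies passing to the limit under the integral.
\<close>

lemma contour_integral_weighted_bound_exists:
  assumes "open S" "f holomorphic_on S" "valid_path \<gamma>" "path_image \<gamma> \<subseteq> S"
  obtains V L where "open V" "bounded V" "path_image \<gamma> \<subseteq> V" "V \<subseteq> S" "L > 0"
    "\<forall>h B. h holomorphic_on V \<longrightarrow> (\<forall>x\<in>V. cmod (h x) \<le> B) \<longrightarrow>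
       cmod (contour_integral \<gamma> (\<lambda>x. f x * h x)) \<le> L * B"
proof -
  have com: "compact (path_image \<gamma>)" using assms by (simp add: compact_valid_path_image)
  have "compact (f ` path_image \<gamma>)"
    using com assms by (intro compact_continuous_image)
      (auto intro: holomorphic_on_imp_continuous_on holomorphic_on_subset)
  then obtain M where M: "M > 0" "f ` path_image \<gamma> \<subseteq> ball 0 M"
    using bounded_subset_ballD[OF compact_imp_bounded] by blast
  obtain r where r: "path_image \<gamma> \<subseteq> ball 0 r"
    using bounded_subset_ballD[OF compact_imp_bounded[OF com]] by blast
  define V where "V = ball 0 r \<inter> (S \<inter> f -` ball 0 M)"
  have "open (S \<inter> f -` ball 0 M)"
    by (rule continuous_open_preimage) (use assms in \<open>auto intro: holomorphic_on_imp_continuous_on\<close>)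
  then have V: "open V" "bounded V" "path_image \<gamma> \<subseteq> V" "V \<subseteq> S" "\<And>x. x \<in> V \<Longrightarrow> cmod (f x) \<le> M"
    unfolding V_def using assms M r by (auto simp: bounded_Int)
  obtain L where L: "L > 0"
    "\<And>f B. f holomorphic_on V \<Longrightarrow> (\<forall>z \<in> V. norm (f z) \<le> B) \<Longrightarrow> norm (contour_integral \<gamma> f) \<le> L*B"
    using contour_integral_bound_exists[OF V(1) assms(3) V(3)] by blast
  show thesis
  proof (rule that[OF V(1-4)])
    show "L * M > 0" using L M by simp
    show "\<forall>h B. h holomorphic_on V \<longrightarrow> (\<forall>x\<in>V. cmod (h x) \<le> B) \<longrightarrow>
       cmod (contour_integral \<gamma> (\<lambda>x. f x * h x)) \<le> L * M * B"
    proof (intro allI impI)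
      fix h B assume h: "h holomorphic_on V" "\<forall>x\<in>V. cmod (h x) \<le> B"
      have "cmod (contour_integral \<gamma> (\<lambda>x. f x * h x)) \<le> L * (M * B)"
      proof (rule L(2))
        show "(\<lambda>x. f x * h x) holomorphic_on V"
          using h(1) holomorphic_on_subset[OF assms(2) V(4)] by (rule holomorphic_on_mult[rotated])
        show "\<forall>x\<in>V. cmod (f x * h x) \<le> M * B"
          using h(2) V(5) M by (auto simp: norm_mult intro!: mult_mono)
      qed
      then show "cmod (contour_integral \<gamma> (\<lambda>x. f x * h x)) \<le> L * M * B" by (simp add: mult_ac)
    qed
  qed
qed

lemma Cauchy_transform_holomorphic:
  assumes "open S" "f holomorphic_on S" "valid_path \<gamma>" "path_image \<gamma> \<subseteq> S"
  shows "(\<lambda>w. contour_integral \<gamma> (\<lambda>x. f x / (x - w))) holomorphic_on - path_image \<gamma>"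
proof -
  let ?C = "\<lambda>w. contour_integral \<gamma> (\<lambda>x. f x / (x - w))"
  have cl: "closed (path_image \<gamma>)"
    by (rule compact_imp_closed[OF compact_valid_path_image[OF assms(3)]])
  have "\<exists>D. (?C has_field_derivative D) (at a)" if a: "a \<notin> path_image \<gamma>" for a
  proof -
    obtain e where e: "e > 0" "cball a e \<subseteq> - path_image \<gamma>"
      using open_contains_cball[of "- path_image \<gamma>"] cl a by auto
    have hol: "f holomorphic_on S - cball a e" using assms(2) by (rule holomorphic_on_subset) auto
    have S': "open (S - cball a e)" using assms(1) by (intro open_Diff) auto
    have im: "path_image \<gamma> \<subseteq> S - cball a e" using assms(4) e by blast
    obtain V L where V: "open V" "bounded V" "path_image \<gamma> \<subseteq> V" "V \<subseteq> S - cball a e" and L: "L > 0"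
      "\<forall>h B. h holomorphic_on V \<longrightarrow> (\<forall>x\<in>V. cmod (h x) \<le> B) \<longrightarrow>
         cmod (contour_integral \<gamma> (\<lambda>x. f x * h x)) \<le> L * B"
      by (rule contour_integral_weighted_bound_exists[OF S' hol assms(3) im])
    \<comment> \<open>Differentiation under the integral sign; the error of the difference quotient has the kernel
        \<open>(w - a) / ((x - w) * (x - a)\<^sup>2)\<close>, of order \<open>\<bar>w - a\<bar>\<close> off the disc around \<open>a\<close>.\<close>
    let ?D = "contour_integral \<gamma> (\<lambda>x. f x / (x - a)\<^sup>2)"
    have V': "cmod (x - a) > e" if "x \<in> V" for x
      using that V by (auto simp: dist_norm norm_minus_commute)
    have int: "(\<lambda>x. f x * k x) contour_integrable_on \<gamma>" if "k holomorphic_on V" for k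
      using that V assms holomorphic_on_subset[of f S V]
      by (intro contour_integrable_holomorphic_simple[of _ V] holomorphic_on_mult) auto
    have bound: "cmod ((?C w - ?C a) / (w - a) - ?D) \<le> L * (2 / e^3 * cmod (w - a))"
      if w: "w \<noteq> a" "cmod (w - a) < e / 2" for w
    proof -
      have xw: "cmod (x - w) \<ge> e / 2" if "x \<in> V" for x
        using V'[OF that] w norm_triangle_ineq[of "x - w" "w - a"] by simp
      have ne: "x \<noteq> w" "x \<noteq> a" if "x \<in> V" for x
        using xw[OF that] V'[OF that] e by auto
      have i: "((\<lambda>x. f x * (1 / (x - u))) has_contour_integral ?C u) \<gamma>" if "\<And>x. x \<in> V \<Longrightarrow> x \<noteq> u" for u
      proof -
        have "(\<lambda>x. 1 / (x - u)) holomorphic_on V" using that by (auto intro!: holomorphic_intros)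
        from has_contour_integral_integral[OF int[OF this]] show ?thesis by simp
      qed
      have i2: "((\<lambda>x. f x * (1 / (x - a)\<^sup>2)) has_contour_integral ?D) \<gamma>"
      proof -
        have "(\<lambda>x. 1 / (x - a)\<^sup>2) holomorphic_on V" using ne by (auto intro!: holomorphic_intros)
        from has_contour_integral_integral[OF int[OF this]] show ?thesis by simp
      qed
      have "((\<lambda>x. (f x * (1 / (x - w)) - f x * (1 / (x - a))) / (w - a) - f x * (1 / (x - a)\<^sup>2))
          has_contour_integral (?C w - ?C a) / (w - a) - ?D) \<gamma>"
        by (intro has_contour_integral_diff has_contour_integral_div i i2 ne)
      then have "((\<lambda>x. f x * ((w - a) / ((x - w) * (x - a)\<^sup>2)))
          has_contour_integral (?C w - ?C a) / (w - a) - ?D) \<gamma>"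
      proof (rule has_contour_integral_eq)
        fix x assume "x \<in> path_image \<gamma>"
        then have x: "x - w \<noteq> 0" "x - a \<noteq> 0" "w - a \<noteq> 0" using ne V w by auto
        have "1 / (x - w) - 1 / (x - a) = (w - a) / ((x - w) * (x - a))"
          using x by (simp add: diff_frac_eq)
        then have "(1 / (x - w) - 1 / (x - a)) / (w - a) = 1 / ((x - w) * (x - a))"
          using x by simp
        moreover have "1 / ((x - w) * (x - a)) - 1 / (x - a)\<^sup>2 = (w - a) / ((x - w) * (x - a)\<^sup>2)"
          using x by (simp add: divide_simps power2_eq_square)
        ultimately show "(f x * (1 / (x - w)) - f x * (1 / (x - a))) / (w - a) - f x * (1 / (x - a)\<^sup>2)
          = f x * ((w - a) / ((x - w) * (x - a)\<^sup>2))"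
          by (metis right_diff_distrib times_divide_eq_right)
      qed
      then have eq: "(?C w - ?C a) / (w - a) - ?D =
          contour_integral \<gamma> (\<lambda>x. f x * ((w - a) / ((x - w) * (x - a)\<^sup>2)))"
        by (simp add: contour_integral_unique)
      show ?thesis unfolding eq
      proof (rule L(2)[rule_format])
        show "(\<lambda>x. (w - a) / ((x - w) * (x - a)\<^sup>2)) holomorphic_on V"
          using ne by (auto intro!: holomorphic_intros)
        fix x assume x: "x \<in> V"
        have "cmod ((w - a) / ((x - w) * (x - a)\<^sup>2)) = cmod (w - a) / (cmod (x - w) * (cmod (x - a))\<^sup>2)"
          by (simp add: norm_divide norm_mult norm_power)
        also have "\<dots> \<le> cmod (w - a) / (e / 2 * e\<^sup>2)"
          using V'[OF x] xw[OF x] e by (intro divide_left_mono mult_mono power_mono mult_pos_pos) auto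
        also have "\<dots> = 2 / e^3 * cmod (w - a)" by (simp add: power2_eq_square power3_eq_cube mult_ac)
        finally show "cmod ((w - a) / ((x - w) * (x - a)\<^sup>2)) \<le> 2 / e^3 * cmod (w - a)" .
      qed
    qed
    have "((\<lambda>w. (?C w - ?C a) / (w - a) - ?D) \<longlongrightarrow> 0) (at a)"
    proof (rule Lim_null_comparison)
      show "eventually (\<lambda>w. cmod ((?C w - ?C a) / (w - a) - ?D) \<le> L * (2 / e^3 * cmod (w - a))) (at a)"
        unfolding eventually_at using bound e by (intro exI[of _ "e/2"]) (auto simp: dist_norm)
      show "((\<lambda>w. L * (2 / e^3 * cmod (w - a))) \<longlongrightarrow> 0) (at a)"
      proof -
        have "((\<lambda>w. L * (2 / e^3 * cmod (w - a))) \<longlongrightarrow> L * (2 / e^3 * cmod (a - a))) (at a)"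
          by (intro tendsto_intros)
        then show ?thesis by simp
      qed
    qed
    then have "(?C has_field_derivative ?D) (at a)"
      unfolding has_field_derivative_iff by (rule LIM_zero_cancel)
    then show ?thesis by blast
  qed
  then show ?thesis using cl by (simp add: holomorphic_on_open open_Compl)
qed

lemma Cauchy_transform_at_infinity:
  assumes "open S" "f holomorphic_on S" "valid_path \<gamma>" "path_image \<gamma> \<subseteq> S"
  shows "((\<lambda>w. w * contour_integral \<gamma> (\<lambda>x. f x / (x - w))) \<longlongrightarrow> - contour_integral \<gamma> f) at_infinity"
proof -
  obtain V L where V: "open V" "bounded V" "path_image \<gamma> \<subseteq> V" "V \<subseteq> S" and L: "L > 0"
      "\<forall>h B. h holomorphic_on V \<longrightarrow> (\<forall>x\<in>V. cmod (h x) \<le> B) \<longrightarrow>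
         cmod (contour_integral \<gamma> (\<lambda>x. f x * h x)) \<le> L * B"
    by (rule contour_integral_weighted_bound_exists[OF assms])
  obtain R where R: "R > 0" "V \<subseteq> ball 0 R" using bounded_subset_ballD[OF V(2)] by blast
  have int: "(\<lambda>x. f x * k x) contour_integrable_on \<gamma>" if "k holomorphic_on V" for k
    using that V assms holomorphic_on_subset[of f S V]
    by (intro contour_integrable_holomorphic_simple[of _ V] holomorphic_on_mult) auto
  have bound: "cmod (w * contour_integral \<gamma> (\<lambda>x. f x / (x - w)) - (- contour_integral \<gamma> f))
      \<le> L * (2 * R * cmod (1 / w))" if w: "cmod w \<ge> 2 * R" for w
  proof -
    have xw: "cmod (x - w) \<ge> cmod w / 2" "cmod x \<le> R" if "x \<in> V" for x
      using w that R norm_triangle_ineq2[of w x] by (auto simp: norm_minus_commute subset_iff)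
    have w0: "w \<noteq> 0" using w R by auto
    have ne: "x \<noteq> w" if "x \<in> V" for x using xw[OF that] w0 by auto
    have "((\<lambda>x. w * (f x * (1 / (x - w))) - (- (f x * 1))) has_contour_integral
        w * contour_integral \<gamma> (\<lambda>x. f x * (1 / (x - w))) - (- contour_integral \<gamma> (\<lambda>x. f x * 1))) \<gamma>"
      using ne by (intro has_contour_integral_diff has_contour_integral_lmul has_contour_integral_neg
          has_contour_integral_integral int holomorphic_intros) auto
    then have "((\<lambda>x. f x * (x / (x - w))) has_contour_integral
        w * contour_integral \<gamma> (\<lambda>x. f x * (1 / (x - w))) - (- contour_integral \<gamma> (\<lambda>x. f x * 1))) \<gamma>"
    proof (rule has_contour_integral_eq)
      fix x assume "x \<in> path_image \<gamma>"
      then have "x - w \<noteq> 0" using ne V by auto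
      then show "w * (f x * (1 / (x - w))) - (- (f x * 1)) = f x * (x / (x - w))"
        by (simp add: field_simps)
    qed
    then have eq: "w * contour_integral \<gamma> (\<lambda>x. f x / (x - w)) - (- contour_integral \<gamma> f)
        = contour_integral \<gamma> (\<lambda>x. f x * (x / (x - w)))"
      by (simp add: contour_integral_unique)
    show ?thesis unfolding eq
    proof (rule L(2)[rule_format])
      show "(\<lambda>x. x / (x - w)) holomorphic_on V" using ne by (auto intro!: holomorphic_intros)
      fix x assume x: "x \<in> V"
      have "cmod (x / (x - w)) \<le> R / (cmod w / 2)"
        unfolding norm_divide using xw[OF x] w0 R by (intro frac_le) auto
      then show "cmod (x / (x - w)) \<le> 2 * R * cmod (1 / w)" by (simp add: norm_divide mult.commute)
    qed
  qed
  have "((\<lambda>w. w * contour_integral \<gamma> (\<lambda>x. f x / (x - w)) - (- contour_integral \<gamma> f)) \<longlongrightarrow> 0) at_infinity"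
  proof (rule Lim_null_comparison)
    show "eventually (\<lambda>w. cmod (w * contour_integral \<gamma> (\<lambda>x. f x / (x - w)) - (- contour_integral \<gamma> f))
      \<le> L * (2 * R * cmod (1 / w))) at_infinity"
      unfolding eventually_at_infinity using bound by blast
    show "((\<lambda>w. L * (2 * R * cmod (1 / w))) \<longlongrightarrow> 0) at_infinity"
    proof -
      have "((\<lambda>w. L * (2 * R * cmod (1 / (w - 0)))) \<longlongrightarrow> L * (2 * R * cmod 0)) at_infinity"
        by (intro tendsto_intros tendsto_inverse_diff_at_infinity)
      then show ?thesis by simp
    qed
  qed
  then show ?thesis by (rule LIM_zero_cancel)
qed

section \<open>The finite expansion and the splitting of the function\<close>

text \<open>
  The data of the theorem for one point \<open>z\<close> and one pair of contours.
\<close>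

locale annular_expansion =
  fixes \<Omega> \<Omega>\<^sub>0 :: "complex set" and f :: "complex \<Rightarrow> complex" and z\<^sub>1 z\<^sub>2 z :: complex
    and \<Gamma>\<^sub>1 \<Gamma>\<^sub>2 :: "real \<Rightarrow> complex"
  assumes closed: "closed \<Omega>\<^sub>0" and opn: "open \<Omega>" and sub: "\<Omega>\<^sub>0 \<subseteq> \<Omega>"
    and hol: "f holomorphic_on \<Omega> - \<Omega>\<^sub>0"
    and z1: "z\<^sub>1 \<in> \<Omega>\<^sub>0" and z2: "z\<^sub>2 \<in> \<Omega> - \<Omega>\<^sub>0" and z: "z \<in> \<Omega> - \<Omega>\<^sub>0"
    and contours: "admissible_contours \<Omega> \<Omega>\<^sub>0 z\<^sub>2 z \<Gamma>\<^sub>1 \<Gamma>\<^sub>2"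
begin

lemma loops: "ccw_loop \<Gamma>\<^sub>1" "ccw_loop \<Gamma>\<^sub>2"
  and nested: "path_image \<Gamma>\<^sub>2 \<subseteq> inside (path_image \<Gamma>\<^sub>1)"
  and images: "path_image \<Gamma>\<^sub>1 \<subseteq> \<Omega> - \<Omega>\<^sub>0" "path_image \<Gamma>\<^sub>2 \<subseteq> \<Omega> - \<Omega>\<^sub>0"
  and core_inside: "\<Omega>\<^sub>0 \<subseteq> inside (path_image \<Gamma>\<^sub>1)" "\<Omega>\<^sub>0 \<subseteq> inside (path_image \<Gamma>\<^sub>2)"
  and inside_domain: "inside (path_image \<Gamma>\<^sub>1) \<subseteq> \<Omega>"
  and points: "z \<in> inside (path_image \<Gamma>\<^sub>1)" "z\<^sub>2 \<in> inside (path_image \<Gamma>\<^sub>1)"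
     "z \<in> outside (path_image \<Gamma>\<^sub>2)" "z\<^sub>2 \<in> outside (path_image \<Gamma>\<^sub>2)"
  using contours by (auto simp: admissible_contours_def)

lemma annulus_open: "open (\<Omega> - \<Omega>\<^sub>0)"
  using opn closed by (rule open_Diff)

lemma annulus: "inside (path_image \<Gamma>\<^sub>1) \<inter> outside (path_image \<Gamma>\<^sub>2) \<subseteq> \<Omega> - \<Omega>\<^sub>0"
  using inside_domain core_inside(2) inside_Int_outside[of "path_image \<Gamma>\<^sub>2"] by blast

lemma outer_subset: "- inside (path_image \<Gamma>\<^sub>1) \<subseteq> outside (path_image \<Gamma>\<^sub>2)"
  by (rule complement_inside_subset_outside[OF loops(1) nested])

lemma off_contours:
  "w \<in> path_image \<Gamma>\<^sub>1 \<Longrightarrow> w \<noteq> z \<and> w \<noteq> z\<^sub>1 \<and> w \<noteq> z\<^sub>2"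
  "w \<in> path_image \<Gamma>\<^sub>2 \<Longrightarrow> w \<noteq> z \<and> w \<noteq> z\<^sub>1 \<and> w \<noteq> z\<^sub>2"
  using points images z1 inside_no_overlap[of "path_image \<Gamma>\<^sub>1"] outside_no_overlap[of "path_image \<Gamma>\<^sub>2"]
  by blast+

lemma distinct: "z \<noteq> z\<^sub>1" "z\<^sub>1 \<noteq> z\<^sub>2"
  using z z1 z2 by auto

lemma punctured_open: "open (\<Omega> - \<Omega>\<^sub>0 - {z, z\<^sub>2})"
  by (rule open_Diff[OF annulus_open]) (simp add: finite_imp_closed)

lemma integrable:
  assumes "h holomorphic_on \<Omega> - \<Omega>\<^sub>0 - {z, z\<^sub>2}"
  shows "h contour_integrable_on \<Gamma>\<^sub>1" "h contour_integrable_on \<Gamma>\<^sub>2"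
  using assms images off_contours ccw_loopD(1)[OF loops(1)] ccw_loopD(1)[OF loops(2)]
  by (auto intro!: contour_integrable_holomorphic_simple[OF _ punctured_open])

lemma hol_punctured: "f holomorphic_on \<Omega> - \<Omega>\<^sub>0 - {z, z\<^sub>2}"
  using hol by (rule holomorphic_on_subset) auto

lemma integrable_rational:
  assumes "h holomorphic_on - {z, z\<^sub>1, z\<^sub>2}"
  shows "(\<lambda>w. f w * h w) contour_integrable_on \<Gamma>\<^sub>1" "(\<lambda>w. f w * h w) contour_integrable_on \<Gamma>\<^sub>2"
proof -
  have "h holomorphic_on \<Omega> - \<Omega>\<^sub>0 - {z, z\<^sub>2}"
    using assms by (rule holomorphic_on_subset) (use z1 in auto)
  from holomorphic_on_mult[OF hol_punctured this]
  show "(\<lambda>w. f w * h w) contour_integrable_on \<Gamma>\<^sub>1" "(\<lambda>w. f w * h w) contour_integrable_on \<Gamma>\<^sub>2"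
    by (auto intro: integrable)
qed

lemma Cauchy_formula:
  "contour_integral \<Gamma>\<^sub>1 (\<lambda>w. f w / (w - z)) - contour_integral \<Gamma>\<^sub>2 (\<lambda>w. f w / (w - z))
    = 2 * of_real pi * \<i> * f z"
  by (rule Cauchy_integral_formula_annulus[OF loops nested annulus_open images annulus hol points(1,3)])

end

text \<open>
  In terms of \<open>B w = (w - z\<^sub>1) * (w - z\<^sub>2)\<close>, this rests on
  \<open>B w - B z = (w - z) * (w + z - z\<^sub>1 - z\<^sub>2)\<close>. The factor \<open>w + z - z\<^sub>1 - z\<^sub>2\<close> is then written as a
  combination of \<open>w - z\<^sub>1\<close> and \<open>w - z\<^sub>2\<close> with coefficients that depend on \<open>z\<close> only, which is where the
  two families of coefficients \<open>d\<close> come from.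
\<close>

lemma two_point_kernel_step:
  fixes w z z\<^sub>1 z\<^sub>2 :: "'a :: field"
  assumes "w \<noteq> z\<^sub>1" "w \<noteq> z\<^sub>2" "w \<noteq> z" "z\<^sub>1 \<noteq> z\<^sub>2"
  shows "1 / ((w - z\<^sub>1) ^ n * (w - z\<^sub>2) ^ n * (w - z)) * ((z - z\<^sub>1) ^ n * (z - z\<^sub>2) ^ n)
      - 1 / ((w - z\<^sub>1) ^ Suc n * (w - z\<^sub>2) ^ Suc n * (w - z)) * ((z - z\<^sub>1) ^ Suc n * (z - z\<^sub>2) ^ Suc n)
    = 1 / ((w - z\<^sub>1) ^ n * (w - z\<^sub>2) ^ (n + 1)) * ((z - z\<^sub>1) * (z - z\<^sub>1) ^ n * (z - z\<^sub>2) ^ n / (z\<^sub>2 - z\<^sub>1))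
      + 1 / ((w - z\<^sub>2) ^ n * (w - z\<^sub>1) ^ (n + 1)) * ((z - z\<^sub>2) * (z - z\<^sub>1) ^ n * (z - z\<^sub>2) ^ n / (z\<^sub>1 - z\<^sub>2))"
proof -
  define a b c \<alpha> \<beta> where "a = w - z\<^sub>1" and "b = w - z\<^sub>2" and "c = w - z"
    and "\<alpha> = z - z\<^sub>1" and "\<beta> = z - z\<^sub>2"
  note defs = this
  define k where "k = \<alpha> ^ n * \<beta> ^ n / (a ^ n * b ^ n)"
  have nz: "a \<noteq> 0" "b \<noteq> 0" "c \<noteq> 0" "z\<^sub>2 - z\<^sub>1 \<noteq> 0" "z\<^sub>1 - z\<^sub>2 \<noteq> 0" using assms by (auto simp: defs)
  have "a * b - \<alpha> * \<beta> = c * (w + z - z\<^sub>1 - z\<^sub>2)" by (simp add: defs algebra_simps)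
  then have "1 / c - \<alpha> * \<beta> / (a * b * c) = (w + z - z\<^sub>1 - z\<^sub>2) / (a * b)"
    using nz by (simp add: divide_simps)
  also have "w + z - z\<^sub>1 - z\<^sub>2 = (\<alpha> * a - \<beta> * b) / (z\<^sub>2 - z\<^sub>1)"
    using nz(4) by (simp add: divide_simps) (simp add: defs algebra_simps)
  also have "(\<alpha> * a - \<beta> * b) / (z\<^sub>2 - z\<^sub>1) / (a * b) = \<alpha> / (b * (z\<^sub>2 - z\<^sub>1)) + \<beta> / (a * (z\<^sub>1 - z\<^sub>2))"
    using nz by (simp add: divide_simps) (simp add: algebra_simps)
  finally have core: "1 / c - \<alpha> * \<beta> / (a * b * c) = \<alpha> / (b * (z\<^sub>2 - z\<^sub>1)) + \<beta> / (a * (z\<^sub>1 - z\<^sub>2))" .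
  have "1 / (a ^ n * b ^ n * c) * (\<alpha> ^ n * \<beta> ^ n)
      - 1 / (a ^ Suc n * b ^ Suc n * c) * (\<alpha> ^ Suc n * \<beta> ^ Suc n)
    = k * (1 / c - \<alpha> * \<beta> / (a * b * c))"
    by (simp add: k_def right_diff_distrib diff_divide_distrib mult_ac)
  also have "\<dots> = 1 / (a ^ n * b ^ (n + 1)) * (\<alpha> * \<alpha> ^ n * \<beta> ^ n / (z\<^sub>2 - z\<^sub>1))
      + 1 / (b ^ n * a ^ (n + 1)) * (\<beta> * \<alpha> ^ n * \<beta> ^ n / (z\<^sub>1 - z\<^sub>2))"
    unfolding core distrib_left by (simp add: k_def mult_ac)
  finally show ?thesis unfolding defs .
qed

text \<open>
  This rests on \<open>(w - z\<^sub>1) * (z - z\<^sub>2) - (w - z\<^sub>2) * (z - z\<^sub>1) = (z\<^sub>1 - z\<^sub>2) * (w - z)\<close>.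
\<close>

lemma quotient_kernel_step:
  fixes w z z\<^sub>1 z\<^sub>2 :: "'a :: field"
  assumes "z \<noteq> z\<^sub>1" "w \<noteq> z\<^sub>2" "w \<noteq> z"
  shows "(w - z\<^sub>1) ^ Suc n / ((w - z\<^sub>2) ^ Suc n * (w - z)) * ((z - z\<^sub>2) ^ Suc n / (z - z\<^sub>1) ^ Suc n)
      - (w - z\<^sub>1) ^ n / ((w - z\<^sub>2) ^ n * (w - z)) * ((z - z\<^sub>2) ^ n / (z - z\<^sub>1) ^ n)
    = (w - z\<^sub>1) ^ n / (w - z\<^sub>2) ^ (n + 1) * ((z\<^sub>1 - z\<^sub>2) * ((z - z\<^sub>2) ^ n / (z - z\<^sub>1) ^ (n + 1)))"
proof -
  define a b c \<alpha> \<beta> where "a = w - z\<^sub>1" and "b = w - z\<^sub>2" and "c = w - z"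
    and "\<alpha> = z - z\<^sub>1" and "\<beta> = z - z\<^sub>2"
  note defs = this
  define k where "k = a ^ n * \<beta> ^ n / (b ^ n * \<alpha> ^ n)"
  have nz: "\<alpha> \<noteq> 0" "b \<noteq> 0" "c \<noteq> 0" using assms by (auto simp: defs)
  have "a * \<beta> - b * \<alpha> = (z\<^sub>1 - z\<^sub>2) * c" by (simp add: defs algebra_simps)
  then have core: "a * \<beta> / (b * \<alpha> * c) - 1 / c = (z\<^sub>1 - z\<^sub>2) / (b * \<alpha>)"
    using nz by (simp add: divide_simps)
  have "a ^ Suc n / (b ^ Suc n * c) * (\<beta> ^ Suc n / \<alpha> ^ Suc n)
      - a ^ n / (b ^ n * c) * (\<beta> ^ n / \<alpha> ^ n)
    = k * (a * \<beta> / (b * \<alpha> * c) - 1 / c)"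
    by (simp add: k_def right_diff_distrib diff_divide_distrib mult_ac)
  also have "\<dots> = a ^ n / b ^ (n + 1) * ((z\<^sub>1 - z\<^sub>2) * (\<beta> ^ n / \<alpha> ^ (n + 1)))"
    unfolding core by (simp add: k_def mult_ac)
  finally show ?thesis unfolding defs .
qed

context annular_expansion
begin

lemma outer_step:
  "1 / (2 * of_real pi * \<i>) *
       contour_integral \<Gamma>\<^sub>1 (\<lambda>w. f w / ((w - z\<^sub>1) ^ n * (w - z\<^sub>2) ^ n * (w - z))) *
       ((z - z\<^sub>1) ^ n * (z - z\<^sub>2) ^ n)
   - 1 / (2 * of_real pi * \<i>) *
       contour_integral \<Gamma>\<^sub>1 (\<lambda>w. f w / ((w - z\<^sub>1) ^ Suc n * (w - z\<^sub>2) ^ Suc n * (w - z))) *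
       ((z - z\<^sub>1) ^ Suc n * (z - z\<^sub>2) ^ Suc n)
   = (coeff_d f \<Gamma>\<^sub>1 n z\<^sub>1 z\<^sub>2 * (z - z\<^sub>1) + coeff_d f \<Gamma>\<^sub>1 n z\<^sub>2 z\<^sub>1 * (z - z\<^sub>2)) *
       (z - z\<^sub>1) ^ n * (z - z\<^sub>2) ^ n"
proof -
  let ?I = "\<lambda>n. contour_integral \<Gamma>\<^sub>1 (\<lambda>w. f w / ((w - z\<^sub>1) ^ n * (w - z\<^sub>2) ^ n * (w - z)))"
  let ?J = "contour_integral \<Gamma>\<^sub>1 (\<lambda>w. f w / ((w - z\<^sub>1) ^ n * (w - z\<^sub>2) ^ (n + 1)))"
  let ?K = "contour_integral \<Gamma>\<^sub>1 (\<lambda>w. f w / ((w - z\<^sub>2) ^ n * (w - z\<^sub>1) ^ (n + 1)))"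
  let ?A = "\<lambda>n. (z - z\<^sub>1) ^ n * (z - z\<^sub>2) ^ n"
  have I: "((\<lambda>w. f w * (1 / ((w - z\<^sub>1) ^ m * (w - z\<^sub>2) ^ m * (w - z)))) has_contour_integral ?I m) \<Gamma>\<^sub>1" for m
  proof -
    have "(\<lambda>w. 1 / ((w - z\<^sub>1) ^ m * (w - z\<^sub>2) ^ m * (w - z))) holomorphic_on - {z, z\<^sub>1, z\<^sub>2}"
      by (intro holomorphic_intros) auto
    from has_contour_integral_integral[OF integrable_rational(1)[OF this]] show ?thesis by simp
  qed
  have JK: "((\<lambda>w. f w * (1 / ((w - a) ^ n * (w - b) ^ (n + 1)))) has_contour_integral
      contour_integral \<Gamma>\<^sub>1 (\<lambda>w. f w / ((w - a) ^ n * (w - b) ^ (n + 1)))) \<Gamma>\<^sub>1"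
    if "{a, b} = {z\<^sub>1, z\<^sub>2}" for a b
  proof -
    have "(\<lambda>w. 1 / ((w - a) ^ n * (w - b) ^ (n + 1))) holomorphic_on - {z, z\<^sub>1, z\<^sub>2}"
      using that by (intro holomorphic_intros) auto
    from has_contour_integral_integral[OF integrable_rational(1)[OF this]] show ?thesis by simp
  qed
  note J = JK[of z\<^sub>1 z\<^sub>2, OF refl] and K = JK[of z\<^sub>2 z\<^sub>1, OF insert_commute]
  let ?c1 = "(z - z\<^sub>1) * (z - z\<^sub>1) ^ n * (z - z\<^sub>2) ^ n / (z\<^sub>2 - z\<^sub>1)"
  let ?c2 = "(z - z\<^sub>2) * (z - z\<^sub>1) ^ n * (z - z\<^sub>2) ^ n / (z\<^sub>1 - z\<^sub>2)"
  have "((\<lambda>w. f w * (1 / ((w - z\<^sub>1) ^ n * (w - z\<^sub>2) ^ n * (w - z))) * ?A n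
        - f w * (1 / ((w - z\<^sub>1) ^ Suc n * (w - z\<^sub>2) ^ Suc n * (w - z))) * ?A (Suc n))
      has_contour_integral ?I n * ?A n - ?I (Suc n) * ?A (Suc n)) \<Gamma>\<^sub>1"
    by (intro has_contour_integral_diff has_contour_integral_rmul I)
  moreover have "((\<lambda>w. f w * (1 / ((w - z\<^sub>1) ^ n * (w - z\<^sub>2) ^ (n + 1))) * ?c1
        + f w * (1 / ((w - z\<^sub>2) ^ n * (w - z\<^sub>1) ^ (n + 1))) * ?c2)
      has_contour_integral ?J * ?c1 + ?K * ?c2) \<Gamma>\<^sub>1"
    by (intro has_contour_integral_add has_contour_integral_rmul J K)
  then have "((\<lambda>w. f w * (1 / ((w - z\<^sub>1) ^ n * (w - z\<^sub>2) ^ n * (w - z))) * ?A n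
        - f w * (1 / ((w - z\<^sub>1) ^ Suc n * (w - z\<^sub>2) ^ Suc n * (w - z))) * ?A (Suc n))
      has_contour_integral ?J * ?c1 + ?K * ?c2) \<Gamma>\<^sub>1"
  proof (rule has_contour_integral_eq)
    fix w assume "w \<in> path_image \<Gamma>\<^sub>1"
    then have "w \<noteq> z\<^sub>1" "w \<noteq> z\<^sub>2" "w \<noteq> z" "z\<^sub>1 \<noteq> z\<^sub>2"
      using off_contours(1) distinct by auto
    from arg_cong[OF two_point_kernel_step[OF this, of n], of "\<lambda>x. f w * x"]
    show "f w * (1 / ((w - z\<^sub>1) ^ n * (w - z\<^sub>2) ^ (n + 1))) * ?c1
        + f w * (1 / ((w - z\<^sub>2) ^ n * (w - z\<^sub>1) ^ (n + 1))) * ?c2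
      = f w * (1 / ((w - z\<^sub>1) ^ n * (w - z\<^sub>2) ^ n * (w - z))) * ?A n
        - f w * (1 / ((w - z\<^sub>1) ^ Suc n * (w - z\<^sub>2) ^ Suc n * (w - z))) * ?A (Suc n)"
      by (simp only: right_diff_distrib[of "f w"] distrib_left[of "f w"] mult.assoc[of "f w"])
  qed
  ultimately have E: "?I n * ?A n - ?I (Suc n) * ?A (Suc n) = ?J * ?c1 + ?K * ?c2"
    by (rule has_contour_integral_unique)
  have "1 / (2 * of_real pi * \<i>) * (?I n * ?A n - ?I (Suc n) * ?A (Suc n))
     = (coeff_d f \<Gamma>\<^sub>1 n z\<^sub>1 z\<^sub>2 * (z - z\<^sub>1) + coeff_d f \<Gamma>\<^sub>1 n z\<^sub>2 z\<^sub>1 * (z - z\<^sub>2)) *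
       (z - z\<^sub>1) ^ n * (z - z\<^sub>2) ^ n"
    unfolding E coeff_d_def by (simp add: distrib_left distrib_right mult_ac)
  then show ?thesis by (simp only: right_diff_distrib mult.assoc)
qed

lemma inner_step:
  "1 / (2 * of_real pi * \<i>) *
       contour_integral \<Gamma>\<^sub>2 (\<lambda>w. (w - z\<^sub>1) ^ Suc n * f w / ((w - z\<^sub>2) ^ Suc n * (w - z))) *
       ((z - z\<^sub>2) ^ Suc n / (z - z\<^sub>1) ^ Suc n)
   - 1 / (2 * of_real pi * \<i>) *
       contour_integral \<Gamma>\<^sub>2 (\<lambda>w. (w - z\<^sub>1) ^ n * f w / ((w - z\<^sub>2) ^ n * (w - z))) *
       ((z - z\<^sub>2) ^ n / (z - z\<^sub>1) ^ n)
   = coeff_e f \<Gamma>\<^sub>2 n z\<^sub>1 z\<^sub>2 * (z - z\<^sub>2) ^ n / (z - z\<^sub>1) ^ (n + 1)"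
proof -
  let ?I = "\<lambda>n. contour_integral \<Gamma>\<^sub>2 (\<lambda>w. (w - z\<^sub>1) ^ n * f w / ((w - z\<^sub>2) ^ n * (w - z)))"
  let ?J = "contour_integral \<Gamma>\<^sub>2 (\<lambda>w. (w - z\<^sub>1) ^ n / (w - z\<^sub>2) ^ (n + 1) * f w)"
  let ?q = "\<lambda>n. (z - z\<^sub>2) ^ n / (z - z\<^sub>1) ^ n"
  have I: "((\<lambda>w. f w * ((w - z\<^sub>1) ^ m / ((w - z\<^sub>2) ^ m * (w - z)))) has_contour_integral ?I m) \<Gamma>\<^sub>2" for m
  proof -
    have "(\<lambda>w. (w - z\<^sub>1) ^ m / ((w - z\<^sub>2) ^ m * (w - z))) holomorphic_on - {z, z\<^sub>1, z\<^sub>2}"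
      by (intro holomorphic_intros) auto
    from has_contour_integral_integral[OF integrable_rational(2)[OF this]]
    show ?thesis by (simp only: times_divide_eq_right mult.commute[of "f _" "(_ - z\<^sub>1) ^ m"])
  qed
  have J: "((\<lambda>w. f w * ((w - z\<^sub>1) ^ n / (w - z\<^sub>2) ^ (n + 1))) has_contour_integral ?J) \<Gamma>\<^sub>2"
  proof -
    have "(\<lambda>w. (w - z\<^sub>1) ^ n / (w - z\<^sub>2) ^ (n + 1)) holomorphic_on - {z, z\<^sub>1, z\<^sub>2}"
      by (intro holomorphic_intros) auto
    from has_contour_integral_integral[OF integrable_rational(2)[OF this]]
    show ?thesis by (simp only: mult.commute[of "f _" "_ / _"])
  qed
  let ?c = "(z\<^sub>1 - z\<^sub>2) * ((z - z\<^sub>2) ^ n / (z - z\<^sub>1) ^ (n + 1))"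
  have "((\<lambda>w. f w * ((w - z\<^sub>1) ^ Suc n / ((w - z\<^sub>2) ^ Suc n * (w - z))) * ?q (Suc n)
        - f w * ((w - z\<^sub>1) ^ n / ((w - z\<^sub>2) ^ n * (w - z))) * ?q n)
      has_contour_integral ?I (Suc n) * ?q (Suc n) - ?I n * ?q n) \<Gamma>\<^sub>2"
    by (intro has_contour_integral_diff has_contour_integral_rmul I)
  moreover have "((\<lambda>w. f w * ((w - z\<^sub>1) ^ n / (w - z\<^sub>2) ^ (n + 1)) * ?c)
      has_contour_integral ?J * ?c) \<Gamma>\<^sub>2"
    by (intro has_contour_integral_rmul J)
  then have "((\<lambda>w. f w * ((w - z\<^sub>1) ^ Suc n / ((w - z\<^sub>2) ^ Suc n * (w - z))) * ?q (Suc n)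
        - f w * ((w - z\<^sub>1) ^ n / ((w - z\<^sub>2) ^ n * (w - z))) * ?q n)
      has_contour_integral ?J * ?c) \<Gamma>\<^sub>2"
  proof (rule has_contour_integral_eq)
    fix w assume "w \<in> path_image \<Gamma>\<^sub>2"
    then have "z \<noteq> z\<^sub>1" "w \<noteq> z\<^sub>2" "w \<noteq> z"
      using off_contours(2) distinct by auto
    from arg_cong[OF quotient_kernel_step[OF this, of n], of "\<lambda>x. f w * x"]
    show "f w * ((w - z\<^sub>1) ^ n / (w - z\<^sub>2) ^ (n + 1)) * ?c
      = f w * ((w - z\<^sub>1) ^ Suc n / ((w - z\<^sub>2) ^ Suc n * (w - z))) * ?q (Suc n)
        - f w * ((w - z\<^sub>1) ^ n / ((w - z\<^sub>2) ^ n * (w - z))) * ?q n"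
      by (simp only: right_diff_distrib[of "f w"] mult.assoc[of "f w"])
  qed
  ultimately have E: "?I (Suc n) * ?q (Suc n) - ?I n * ?q n = ?J * ?c"
    by (rule has_contour_integral_unique)
  have "1 / (2 * of_real pi * \<i>) * (?I (Suc n) * ?q (Suc n) - ?I n * ?q n)
     = coeff_e f \<Gamma>\<^sub>2 n z\<^sub>1 z\<^sub>2 * (z - z\<^sub>2) ^ n / (z - z\<^sub>1) ^ (n + 1)"
    unfolding E coeff_e_def by (simp add: mult_ac)
  then show ?thesis by (simp only: right_diff_distrib mult.assoc)
qed

theorem expansion:
  "f z = (\<Sum>n<N. (coeff_d f \<Gamma>\<^sub>1 n z\<^sub>1 z\<^sub>2 * (z - z\<^sub>1) + coeff_d f \<Gamma>\<^sub>1 n z\<^sub>2 z\<^sub>1 * (z - z\<^sub>2)) *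
             (z - z\<^sub>1) ^ n * (z - z\<^sub>2) ^ n) +
         (\<Sum>n<N. coeff_e f \<Gamma>\<^sub>2 n z\<^sub>1 z\<^sub>2 * (z - z\<^sub>2) ^ n / (z - z\<^sub>1) ^ (n + 1)) +
         remainder f \<Gamma>\<^sub>1 \<Gamma>\<^sub>2 N z\<^sub>1 z\<^sub>2 z"
proof -
  define T where "T = (\<lambda>n. 1 / (2 * of_real pi * \<i>) *
       contour_integral \<Gamma>\<^sub>1 (\<lambda>w. f w / ((w - z\<^sub>1) ^ n * (w - z\<^sub>2) ^ n * (w - z))) *
       ((z - z\<^sub>1) ^ n * (z - z\<^sub>2) ^ n))"
  define S where "S = (\<lambda>n. 1 / (2 * of_real pi * \<i>) *
       contour_integral \<Gamma>\<^sub>2 (\<lambda>w. (w - z\<^sub>1) ^ n * f w / ((w - z\<^sub>2) ^ n * (w - z))) *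
       ((z - z\<^sub>2) ^ n / (z - z\<^sub>1) ^ n))"
  have R: "remainder f \<Gamma>\<^sub>1 \<Gamma>\<^sub>2 n z\<^sub>1 z\<^sub>2 z = T n - S n" for n
    unfolding remainder_def T_def S_def ..
  have "(\<Sum>n<N. T n - T (Suc n)) = T 0 - T N" "(\<Sum>n<N. S (Suc n) - S n) = S N - S 0"
    by (induction N) auto
  moreover have "T 0 - S 0 = f z"
    using Cauchy_formula by (simp add: T_def S_def diff_divide_distrib[symmetric])
  moreover have "T n - T (Suc n) = (coeff_d f \<Gamma>\<^sub>1 n z\<^sub>1 z\<^sub>2 * (z - z\<^sub>1) + coeff_d f \<Gamma>\<^sub>1 n z\<^sub>2 z\<^sub>1 * (z - z\<^sub>2)) *
       (z - z\<^sub>1) ^ n * (z - z\<^sub>2) ^ n"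
    and "S (Suc n) - S n = coeff_e f \<Gamma>\<^sub>2 n z\<^sub>1 z\<^sub>2 * (z - z\<^sub>2) ^ n / (z - z\<^sub>1) ^ (n + 1)" for n
    unfolding T_def S_def by (rule outer_step, rule inner_step)
  ultimately show ?thesis unfolding R by simp
qed

text \<open>
  With \<open>C \<Gamma>\<close> the Cauchy transform of \<open>f\<close> along \<open>\<Gamma>\<close>, \<open>f = C \<Gamma>\<^sub>1 - C \<Gamma>\<^sub>2\<close> between the contours. There
  \<open>f\<^sub>1\<close> is \<open>C \<Gamma>\<^sub>1\<close> and \<open>f\<^sub>2\<close> is \<open>- C \<Gamma>\<^sub>2\<close>, and where one of these formulas ends, the other one
  together with \<open>f = f\<^sub>1 + f\<^sub>2\<close> continues the function.
\<close>

lemma Laurent_split: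
  obtains f\<^sub>1 f\<^sub>2 c where "f\<^sub>1 holomorphic_on \<Omega>" "f\<^sub>2 holomorphic_on - \<Omega>\<^sub>0"
    "\<And>w. w \<in> \<Omega> - \<Omega>\<^sub>0 \<Longrightarrow> f w = f\<^sub>1 w + f\<^sub>2 w"
    "((\<lambda>w. w * f\<^sub>2 w) \<longlongrightarrow> c) at_infinity"
proof -
  define C where "C = (\<lambda>\<Gamma> w. 1 / (2 * of_real pi * \<i>) * contour_integral \<Gamma> (\<lambda>x. f x / (x - w)))"
  note G1 = ccw_loopD[OF loops(1)] and G2 = ccw_loopD[OF loops(2)]
  have hC: "C \<Gamma>\<^sub>1 holomorphic_on - path_image \<Gamma>\<^sub>1" "C \<Gamma>\<^sub>2 holomorphic_on - path_image \<Gamma>\<^sub>2"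
    unfolding C_def
    by (intro holomorphic_on_mult holomorphic_on_const Cauchy_transform_holomorphic[OF annulus_open hol]
        G1(1) G2(1) images)+
  have C1: "C \<Gamma>\<^sub>1 holomorphic_on inside (path_image \<Gamma>\<^sub>1)"
    using hC(1) by (rule holomorphic_on_subset) (use inside_Un_outside[of "path_image \<Gamma>\<^sub>1"] in blast)
  have C2: "C \<Gamma>\<^sub>2 holomorphic_on outside (path_image \<Gamma>\<^sub>2)"
    using hC(2) by (rule holomorphic_on_subset) (use inside_Un_outside[of "path_image \<Gamma>\<^sub>2"] in blast)
  have CC: "f w = C \<Gamma>\<^sub>1 w - C \<Gamma>\<^sub>2 w" if "w \<in> inside (path_image \<Gamma>\<^sub>1)" "w \<in> outside (path_image \<Gamma>\<^sub>2)" for w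
    using Cauchy_integral_formula_annulus[OF loops nested annulus_open images annulus hol that]
    by (simp add: C_def diff_divide_distrib[symmetric])
  define f\<^sub>1 where "f\<^sub>1 = (\<lambda>w. if w \<in> inside (path_image \<Gamma>\<^sub>1) then C \<Gamma>\<^sub>1 w else f w + C \<Gamma>\<^sub>2 w)"
  define f\<^sub>2 where "f\<^sub>2 = (\<lambda>w. if w \<in> outside (path_image \<Gamma>\<^sub>2) then - C \<Gamma>\<^sub>2 w else f w - C \<Gamma>\<^sub>1 w)"
  show thesis
  proof (rule that)
    let ?W = "(\<Omega> - \<Omega>\<^sub>0) \<inter> outside (path_image \<Gamma>\<^sub>2)"
    have "f\<^sub>1 holomorphic_on inside (path_image \<Gamma>\<^sub>1) \<union> ?W"
      unfolding f\<^sub>1_def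
    proof (rule holomorphic_on_If_Un[OF C1 _ G1(6)])
      show "(\<lambda>w. f w + C \<Gamma>\<^sub>2 w) holomorphic_on ?W"
        by (intro holomorphic_on_add holomorphic_on_subset[OF hol] holomorphic_on_subset[OF C2]) auto
    qed (use annulus_open G2 CC in auto)
    moreover have "\<Omega> \<subseteq> inside (path_image \<Gamma>\<^sub>1) \<union> ?W" using outer_subset core_inside(1) by blast
    ultimately show "f\<^sub>1 holomorphic_on \<Omega>" by (rule holomorphic_on_subset)
    let ?V = "(\<Omega> - \<Omega>\<^sub>0) \<inter> inside (path_image \<Gamma>\<^sub>1)"
    have "f\<^sub>2 holomorphic_on outside (path_image \<Gamma>\<^sub>2) \<union> ?V"
      unfolding f\<^sub>2_def
    proof (rule holomorphic_on_If_Un[OF _ _ G2(7)])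
      show "(\<lambda>w. - C \<Gamma>\<^sub>2 w) holomorphic_on outside (path_image \<Gamma>\<^sub>2)"
        by (intro holomorphic_on_minus C2)
      show "(\<lambda>w. f w - C \<Gamma>\<^sub>1 w) holomorphic_on ?V"
        by (intro holomorphic_on_diff holomorphic_on_subset[OF hol] holomorphic_on_subset[OF C1]) auto
    qed (use annulus_open G1 CC in auto)
    moreover have "- \<Omega>\<^sub>0 \<subseteq> outside (path_image \<Gamma>\<^sub>2) \<union> ?V" using outer_subset inside_domain by blast
    ultimately show "f\<^sub>2 holomorphic_on - \<Omega>\<^sub>0" by (rule holomorphic_on_subset)
    show "f w = f\<^sub>1 w + f\<^sub>2 w" if "w \<in> \<Omega> - \<Omega>\<^sub>0" for w
      using CC[of w] outer_subset by (auto simp: f\<^sub>1_def f\<^sub>2_def)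
    let ?c = "1 / (2 * of_real pi * \<i>) * contour_integral \<Gamma>\<^sub>2 f"
    have "((\<lambda>w. - (1 / (2 * of_real pi * \<i>) * (w * contour_integral \<Gamma>\<^sub>2 (\<lambda>x. f x / (x - w))))) \<longlongrightarrow>
        - (1 / (2 * of_real pi * \<i>) * (- contour_integral \<Gamma>\<^sub>2 f))) at_infinity"
      by (intro tendsto_intros Cauchy_transform_at_infinity[OF annulus_open hol G2(1) images(2)])
    moreover obtain r where r: "path_image \<Gamma>\<^sub>1 \<union> inside (path_image \<Gamma>\<^sub>1) \<subseteq> ball 0 r"
    proof -
      have "bounded (path_image \<Gamma>\<^sub>1 \<union> inside (path_image \<Gamma>\<^sub>1))"
        using compact_imp_bounded[OF G1(4)] by (simp add: bounded_inside)
      from bounded_subset_ballD[OF this, of 0] show thesis using that by blast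
    qed
    have "w \<in> outside (path_image \<Gamma>\<^sub>2)" if "cmod w \<ge> r" for w
    proof -
      have "w \<notin> ball 0 r" using that by simp
      then show ?thesis using r outer_subset by blast
    qed
    then have "eventually (\<lambda>w. - (1 / (2 * of_real pi * \<i>) * (w * contour_integral \<Gamma>\<^sub>2 (\<lambda>x. f x / (x - w))))
       = w * f\<^sub>2 w) at_infinity"
      unfolding eventually_at_infinity by (intro exI[of _ r]) (auto simp: f\<^sub>2_def C_def)
    ultimately show "((\<lambda>w. w * f\<^sub>2 w) \<longlongrightarrow> ?c) at_infinity"
      by (simp add: tendsto_cong)
  qed
qed

end

section \<open>Taylor expansions in a quadratic polynomial and in a quotient\<close>

text \<open>
  The polynomials must be the same sections of one series for all \<open>N\<close>: the first property gives
  their convergence, the second the exact divisibility of the rest by \<open>u ^ N\<close>.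
\<close>

lemma holomorphic_Taylor_tails:
  fixes g :: "complex \<Rightarrow> complex"
  assumes g: "g holomorphic_on ball 0 r"
  obtains c :: "nat \<Rightarrow> complex"
  where "\<forall>u \<in> ball 0 r. (\<lambda>n. c n * u ^ n) sums g u"
    and "\<forall>N. \<exists>k. k holomorphic_on ball 0 r \<and>
           (\<forall>u \<in> ball 0 r. g u = (\<Sum>n<N. c n * u ^ n) + u ^ N * k u)"
proof
  define c where "c = (\<lambda>n. (deriv ^^ n) g 0 / fact n)"
  have sums: "(\<lambda>n. c n * u ^ n) sums g u" if "u \<in> ball 0 r" for u
    using holomorphic_power_series[OF g that] by (simp add: c_def)
  then show "\<forall>u \<in> ball 0 r. (\<lambda>n. c n * u ^ n) sums g u" by blast
  show "\<forall>N. \<exists>k. k holomorphic_on ball 0 r \<and> (\<forall>u \<in> ball 0 r. g u = (\<Sum>n<N. c n * u ^ n) + u ^ N * k u)"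
  proof (intro allI exI conjI ballI)
    fix N :: nat
    let ?k = "\<lambda>u. \<Sum>n. c (n + N) * u ^ n"
    have summ: "summable (\<lambda>n. c (n + N) * u ^ n)" if "u \<in> ball 0 r" for u
      using sums_summable[OF sums[OF that]] by (simp add: summable_powser_ignore_initial_segment)
    show "?k holomorphic_on ball 0 r"
      by (rule power_series_holomorphic[of 0 r "\<lambda>n. c (n + N)"]) (use summ in \<open>auto intro: summable_sums\<close>)
    fix u :: complex assume u: "u \<in> ball 0 r"
    have "g u = (\<Sum>n. c (n + N) * u ^ (n + N)) + (\<Sum>n<N. c n * u ^ n)"
      using sums[OF u] suminf_split_initial_segment[of "\<lambda>n. c n * u ^ n" N]
      by (simp add: sums_iff)
    also have "(\<lambda>n. c (n + N) * u ^ (n + N)) = (\<lambda>n. u ^ N * (c (n + N) * u ^ n))"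
      by (simp add: power_add mult_ac)
    also have "suminf \<dots> = u ^ N * ?k u" using summ[OF u] by (rule suminf_mult)
    finally show "g u = (\<Sum>n<N. c n * u ^ n) + u ^ N * ?k u" by simp
  qed
qed

text \<open>
  On the overlap of \<open>W\<^sub>0\<close> with the set where \<open>D\<close> has no zeros, the given quotient \<open>K\<close> and \<open>F / D\<close>
  agree.
\<close>

lemma holomorphic_quotient_glue:
  assumes "open W" "open W\<^sub>0" "W\<^sub>0 \<subseteq> W" "F holomorphic_on W" "D holomorphic_on W" "K holomorphic_on W\<^sub>0"
    and eq: "\<And>w. w \<in> W\<^sub>0 \<Longrightarrow> F w = D w * K w" and nz: "\<And>w. w \<in> W - W\<^sub>0 \<Longrightarrow> D w \<noteq> 0"
  obtains H where "H holomorphic_on W" "\<forall>w \<in> W. F w = D w * H w"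
proof
  let ?V = "{w \<in> W. D w \<noteq> 0}"
  let ?H = "\<lambda>w. if w \<in> W\<^sub>0 then K w else F w / D w"
  have "?V = W \<inter> D -` (- {0})" by auto
  moreover have "open (W \<inter> D -` (- {0}))"
    by (rule continuous_open_preimage)
       (use assms in \<open>auto intro: holomorphic_on_imp_continuous_on\<close>)
  ultimately have V: "open ?V" by simp
  have "?H holomorphic_on W\<^sub>0 \<union> ?V"
  proof (rule holomorphic_on_If_Un)
    show "(\<lambda>w. F w / D w) holomorphic_on ?V"
      by (intro holomorphic_on_divide holomorphic_on_subset[OF assms(4)] holomorphic_on_subset[OF assms(5)]) auto
  qed (use assms V in auto)
  moreover have "W \<subseteq> W\<^sub>0 \<union> ?V" using nz by auto
  ultimately show "?H holomorphic_on W" by (rule holomorphic_on_subset)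
  show "\<forall>w \<in> W. F w = D w * ?H w" using eq nz by auto
qed

text \<open>
  An even function does not see which square root is taken. Hence it may be composed with
  \<open>csqrt s\<close> away from the negative axis and with the branch \<open>\<i> * csqrt (- s)\<close> away from the positive
  axis, and the branch point \<open>0\<close> is removable by continuity.
\<close>

lemma even_holomorphic_csqrt:
  assumes T: "open T" and E: "E holomorphic_on {v. v\<^sup>2 \<in> T}"
    and even: "\<And>v. v\<^sup>2 \<in> T \<Longrightarrow> E (- v) = E v"
  shows "(\<lambda>s. E (csqrt s)) holomorphic_on T"
proof -
  let ?G = "\<lambda>s. E (csqrt s)"
  have *: "?G s = E v" if "v\<^sup>2 = s" "s \<in> T" for s v
  proof -
    have "(csqrt s)\<^sup>2 = v\<^sup>2" using that by simp
    then have "csqrt s = v \<or> csqrt s = - v" by (simp only: power2_eq_iff)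
    then show ?thesis using even[of v] that by auto
  qed
  have V: "open {v. v\<^sup>2 \<in> T}"
    using open_vimage[OF T continuous_on_power[OF continuous_on_id, of UNIV 2]] by (simp add: vimage_def)
  have op: "open (T - \<real>\<^sub>\<le>\<^sub>0)" "open (T - uminus ` \<real>\<^sub>\<le>\<^sub>0)"
    using T by (auto intro!: open_Diff closed_negations)
  have "?G holomorphic_on T - \<real>\<^sub>\<le>\<^sub>0"
    by (rule holomorphic_on_compose_gen[unfolded o_def, OF _ E]) (auto intro!: holomorphic_intros)
  moreover have "(\<lambda>s. E (\<i> * csqrt (- s))) holomorphic_on T - uminus ` \<real>\<^sub>\<le>\<^sub>0"
  proof (rule holomorphic_on_compose_gen[unfolded o_def, OF _ E])
    have "- s \<notin> \<real>\<^sub>\<le>\<^sub>0" if "s \<in> T - uminus ` \<real>\<^sub>\<le>\<^sub>0" for s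
      using that by (metis DiffD2 add.inverse_inverse imageI)
    then show "(\<lambda>s. \<i> * csqrt (- s)) holomorphic_on T - uminus ` \<real>\<^sub>\<le>\<^sub>0"
      by (intro holomorphic_intros)
  qed (auto simp: power_mult_distrib)
  then have "?G holomorphic_on T - uminus ` \<real>\<^sub>\<le>\<^sub>0"
    by (rule holomorphic_transform) (auto simp: power_mult_distrib intro!: *[symmetric])
  ultimately have "?G holomorphic_on (T - \<real>\<^sub>\<le>\<^sub>0) \<union> (T - uminus ` \<real>\<^sub>\<le>\<^sub>0)"
    using op by (intro holomorphic_on_Un)
  moreover have "T - {0} \<subseteq> (T - \<real>\<^sub>\<le>\<^sub>0) \<union> (T - uminus ` \<real>\<^sub>\<le>\<^sub>0)"
    by (auto simp: complex_nonpos_Reals_iff complex_eq_iff)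
  ultimately have hol: "?G holomorphic_on T - {0}" by (rule holomorphic_on_subset)
  show ?thesis
  proof (cases "0 \<in> T")
    case False then show ?thesis using hol by simp
  next
    case True
    have "isCont E 0"
      using E V True by (intro continuous_on_interior[of "{v. v\<^sup>2 \<in> T}"])
        (auto intro: holomorphic_on_imp_continuous_on simp: interior_open)
    moreover have "(csqrt \<longlongrightarrow> 0) (at 0)"
    proof (rule tendsto_norm_zero_cancel)
      have "((\<lambda>s::complex. sqrt (norm s)) \<longlongrightarrow> sqrt (norm (0::complex))) (at 0)"
        by (intro tendsto_intros)
      then show "((\<lambda>s. norm (csqrt s)) \<longlongrightarrow> 0) (at 0)" by simp
    qed
    ultimately have "?G \<midarrow>0\<rightarrow> E 0" by (rule isCont_tendsto_compose)
    from removable_singularity[OF hol T this] show ?thesis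
      by (rule holomorphic_transform) simp
  qed
qed

text \<open>
  Centred at the midpoint of \<open>a\<close> and \<open>b\<close>, that is with \<open>w = (a + b) / 2 + v\<close>, the polynomial
  \<open>(w - a) * (w - b)\<close> is \<open>v\<^sup>2 - d\<^sup>2\<close>, so functions of it are the even functions of \<open>v\<close>. The functions \<open>g\<close> and \<open>h\<close>
  come from the even part of \<open>F\<close> and from its odd part divided by \<open>v\<close>.
\<close>

lemma lemniscate_decomposition:
  fixes a b :: complex
  assumes F: "F holomorphic_on {w. cmod ((w - a) * (w - b)) < r}"
  obtains g h where "g holomorphic_on ball 0 r" "h holomorphic_on ball 0 r"
    "\<forall>w. cmod ((w - a) * (w - b)) < r \<longrightarrow>
       F w = g ((w - a) * (w - b)) + (w - (a + b) / 2) * h ((w - a) * (w - b))"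
proof -
  define m d where "m = (a + b) / 2" and "d = (a - b) / 2"
  let ?T = "ball (d\<^sup>2) r" and ?V = "{v. v\<^sup>2 \<in> ball (d\<^sup>2) r}"
  have B: "(m + v - a) * (m + v - b) = v\<^sup>2 - d\<^sup>2" for v
    by (simp add: m_def d_def power2_eq_square field_simps)
  have V: "v \<in> ?V \<longleftrightarrow> cmod ((m + v - a) * (m + v - b)) < r" for v
    unfolding B by (simp add: dist_norm norm_minus_commute)
  have Vsym: "- v \<in> ?V \<longleftrightarrow> v \<in> ?V" for v by simp
  have openV: "open ?V"
    using open_vimage[OF open_ball continuous_on_power[OF continuous_on_id, of UNIV 2], of "d\<^sup>2" r]
    by (simp add: vimage_def)
  have hp: "(\<lambda>v. F (m + v)) holomorphic_on ?V"
    by (rule holomorphic_on_compose_gen[unfolded o_def, OF _ F]) (use V in \<open>auto intro!: holomorphic_intros\<close>)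
  have hm: "(\<lambda>v. F (m - v)) holomorphic_on ?V"
  proof (rule holomorphic_on_compose_gen[unfolded o_def, OF _ F])
    show "(\<lambda>v. m - v) ` ?V \<subseteq> {w. cmod ((w - a) * (w - b)) < r}"
      using V[of "- v" for v] Vsym by auto
  qed (intro holomorphic_intros)
  define E Od where "E = (\<lambda>v. (F (m + v) + F (m - v)) / 2)" and "Od = (\<lambda>v. (F (m + v) - F (m - v)) / 2)"
  define E' where "E' = (\<lambda>v. if v = 0 then deriv Od 0 else (Od v - Od 0) / (v - 0))"
  have hol: "E holomorphic_on ?V" "Od holomorphic_on ?V"
    unfolding E_def Od_def by (intro holomorphic_intros hp hm; simp)+
  have hol': "E' holomorphic_on ?V" unfolding E'_def by (rule pole_lemma_open[OF hol(2) openV])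
  have even: "E (- v) = E v" "E' (- v) = E' v" for v
    by (simp_all add: E_def E'_def Od_def field_simps)
  define g h where "g = (\<lambda>u. E (csqrt (u + d\<^sup>2)))" and "h = (\<lambda>u. E' (csqrt (u + d\<^sup>2)))"
  have shift: "(\<lambda>u. k (u + d\<^sup>2)) holomorphic_on ball 0 r" if "k holomorphic_on ?T" for k
    by (rule holomorphic_on_compose_gen[unfolded o_def, OF _ that])
       (auto simp: dist_norm intro!: holomorphic_intros)
  show thesis
  proof (rule that; (intro allI impI)?)
    show "g holomorphic_on ball 0 r" "h holomorphic_on ball 0 r"
      unfolding g_def h_def
      by (rule shift, rule even_holomorphic_csqrt[OF open_ball], use hol hol' even in auto)+
    fix w assume w: "cmod ((w - a) * (w - b)) < r"
    define v where "v = w - m"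
    have wv: "w = m + v" "(w - a) * (w - b) = v\<^sup>2 - d\<^sup>2" "w - (a + b) / 2 = v"
      using B[of v] by (simp_all add: v_def m_def)
    have "csqrt (v\<^sup>2) = v \<or> csqrt (v\<^sup>2) = - v" by (metis power2_csqrt power2_eq_iff)
    then have "g (v\<^sup>2 - d\<^sup>2) = E v" "h (v\<^sup>2 - d\<^sup>2) = E' v" using even by (auto simp: g_def h_def)
    moreover have "E v + v * E' v = F (m + v)"
      by (simp add: E_def E'_def Od_def field_simps)
    ultimately show "F w = g ((w - a) * (w - b)) + (w - (a + b) / 2) * h ((w - a) * (w - b))"
      unfolding wv(2,3) by (simp add: wv(1))
  qed
qed

text \<open>
  The Moebius map \<open>w \<mapsto> (w - b) / (w - a)\<close> has the inverse \<open>W p = a + (b - a) / (1 - p)\<close> and takes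
  infinity to \<open>1\<close>. The factor \<open>w - a\<close> cancels the zero of \<open>f\<close> at infinity, so that
  \<open>\<psi> p = (W p - a) * f (W p)\<close> has the finite limit \<open>c\<close> at \<open>p = 1\<close> and the singularity there is
  removable.
\<close>

lemma exterior_quotient_expansion:
  assumes f: "f holomorphic_on - K" and a: "a \<in> K" and ab: "a \<noteq> b"
    and lim: "((\<lambda>w. w * f w) \<longlongrightarrow> c) at_infinity"
    and r: "\<And>w. w \<noteq> a \<Longrightarrow> cmod ((w - b) / (w - a)) < r \<Longrightarrow> w \<notin> K"
  obtains \<psi> where "\<psi> holomorphic_on ball 0 r"
    "\<forall>w. w \<noteq> a \<longrightarrow> (w - a) * f w = \<psi> ((w - b) / (w - a))"
proof -
  define W where "W = (\<lambda>p. a + (b - a) / (1 - p))"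
  define \<psi> where "\<psi> = (\<lambda>p. if p = 1 then c else (W p - a) * f (W p))"
  have Wp: "W p \<noteq> a" "(W p - b) / (W p - a) = p" if "p \<noteq> 1" for p
  proof -
    have nz: "1 - p \<noteq> 0" "b - a \<noteq> 0" using that ab by auto
    then show "W p \<noteq> a" by (simp add: W_def)
    have "W p - b = p * (b - a) / (1 - p)" using nz by (simp add: W_def field_simps)
    then show "(W p - b) / (W p - a) = p" using nz by (simp add: W_def)
  qed
  have pW: "(w - b) / (w - a) \<noteq> 1" "W ((w - b) / (w - a)) = w" if "w \<noteq> a" for w
  proof -
    have "w - a \<noteq> 0" using that by auto
    then show "(w - b) / (w - a) \<noteq> 1" using ab by auto
    have "1 - (w - b) / (w - a) = (b - a) / (w - a)" using \<open>w - a \<noteq> 0\<close> by (simp add: field_simps)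
    then show "W ((w - b) / (w - a)) = w" using ab \<open>w - a \<noteq> 0\<close> by (simp add: W_def)
  qed
  have Wh: "W holomorphic_on ball 0 r - {1}" unfolding W_def by (intro holomorphic_intros) auto
  have "(\<lambda>p. f (W p)) holomorphic_on ball 0 r - {1}"
  proof (rule holomorphic_on_compose_gen[unfolded o_def, OF Wh f])
    show "W ` (ball 0 r - {1}) \<subseteq> - K" using r[of "W p" for p] Wp by auto
  qed
  then have "(\<lambda>p. (W p - a) * f (W p)) holomorphic_on ball 0 r - {1}"
    by (intro holomorphic_intros Wh)
  moreover have "((\<lambda>p. (W p - a) * f (W p)) \<longlongrightarrow> c) (at 1)"
  proof (rule filterlim_compose[of "\<lambda>w. (w - a) * f w"])
    have "((\<lambda>w. (w - a) / (w - 0) * (w * f w)) \<longlongrightarrow> 1 * c) at_infinity"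
      by (intro tendsto_intros lim tendsto_quotient_diff_at_infinity)
    moreover have "eventually (\<lambda>w. (w - a) / (w - 0) * (w * f w) = (w - a) * f w) at_infinity"
      by (rule eventually_mono[OF eventually_not_equal_at_infinity[of 0]]) simp
    ultimately show "((\<lambda>w. (w - a) * f w) \<longlongrightarrow> c) at_infinity" by (simp add: tendsto_cong)
    have "filterlim (\<lambda>p. 1 - p) (at 0) (at (1::complex))"
      unfolding filterlim_at by (auto simp: eventually_at_filter intro!: tendsto_eq_intros)
    then have "filterlim (\<lambda>p. (b - a) / (1 - p)) at_infinity (at 1)"
      using ab by (intro filterlim_divide_at_infinity[OF tendsto_const]) auto
    then show "filterlim W at_infinity (at 1)"
      unfolding W_def by (rule tendsto_add_filterlim_at_infinity[OF tendsto_const])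
  qed
  ultimately have "\<psi> holomorphic_on ball 0 r"
    unfolding \<psi>_def by (intro removable_singularity) auto
  moreover have "(w - a) * f w = \<psi> ((w - b) / (w - a))" if "w \<noteq> a" for w
    unfolding \<psi>_def pW(2)[OF that] by (simp only: pW(1)[OF that] if_False)
  ultimately show thesis using that by blast
qed

section \<open>Convergence of the remainder\<close>

context annular_expansion
begin

text \<open>
  With \<open>f\<^sub>1 = Q N + B ^ N * H\<close>, the integrand is \<open>H w / (w - z)\<close>, whose integral is given by Cauchy's
  formula, plus \<open>(Q N w + f\<^sub>2 w) / B w ^ N / (w - z)\<close>. As a polynomial \<open>Q N\<close> has degree below \<open>2 * N\<close>,
  so the latter is \<open>o(1 / w)\<close> at infinity and, being holomorphic outside the contour, has integral \<open>0\<close>.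
  The remainder is therefore \<open>f\<^sub>1 z - Q N z\<close>.
\<close>

lemma lemniscate_remainder_tendsto_0:
  assumes f1: "f\<^sub>1 holomorphic_on \<Omega>" and f2: "f\<^sub>2 holomorphic_on - \<Omega>\<^sub>0"
    and split: "\<And>w. w \<in> \<Omega> - \<Omega>\<^sub>0 \<Longrightarrow> f w = f\<^sub>1 w + f\<^sub>2 w"
    and lim: "(f\<^sub>2 \<longlongrightarrow> 0) at_infinity"
    and \<rho>: "{w. cmod ((w - z\<^sub>1) * (w - z\<^sub>2)) < \<rho>} \<subseteq> \<Omega>" "cmod ((z - z\<^sub>1) * (z - z\<^sub>2)) < \<rho>"
  shows "(\<lambda>N. 1 / (2 * of_real pi * \<i>) *
       contour_integral \<Gamma>\<^sub>1 (\<lambda>w. f w / ((w - z\<^sub>1) ^ N * (w - z\<^sub>2) ^ N * (w - z))) *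
       ((z - z\<^sub>1) ^ N * (z - z\<^sub>2) ^ N)) \<longlonglongrightarrow> 0"
proof -
  define m where "m = (z\<^sub>1 + z\<^sub>2) / 2"
  define B where "B = (\<lambda>w. (w - z\<^sub>1) * (w - z\<^sub>2))"
  let ?L = "{w. cmod (B w) < \<rho>}"
  have L: "?L \<subseteq> \<Omega>" "z \<in> ?L" using \<rho> by (auto simp: B_def)
  have "open (B -` ball 0 \<rho>)" unfolding B_def by (intro open_vimage open_ball continuous_intros)
  then have openL: "open ?L" by (simp add: vimage_def)
  have holB: "B holomorphic_on X" for X unfolding B_def by (intro holomorphic_intros)
  obtain g h where gh: "g holomorphic_on ball 0 \<rho>" "h holomorphic_on ball 0 \<rho>"
    and dec0: "\<forall>w. cmod (B w) < \<rho> \<longrightarrow> f\<^sub>1 w = g (B w) + (w - m) * h (B w)"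
    unfolding B_def m_def
    by (rule lemniscate_decomposition[OF holomorphic_on_subset[OF f1 \<rho>(1)]])
  note dec = dec0[rule_format]
  obtain c where c0: "\<forall>u \<in> ball 0 \<rho>. (\<lambda>n. c n * u ^ n) sums g u"
    "\<forall>N. \<exists>k. k holomorphic_on ball 0 \<rho> \<and> (\<forall>u \<in> ball 0 \<rho>. g u = (\<Sum>n<N. c n * u ^ n) + u ^ N * k u)"
    by (rule holomorphic_Taylor_tails[OF gh(1)])
  note c = c0[rule_format]
  obtain e where e0: "\<forall>u \<in> ball 0 \<rho>. (\<lambda>n. e n * u ^ n) sums h u"
    "\<forall>N. \<exists>k. k holomorphic_on ball 0 \<rho> \<and> (\<forall>u \<in> ball 0 \<rho>. h u = (\<Sum>n<N. e n * u ^ n) + u ^ N * k u)"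
    by (rule holomorphic_Taylor_tails[OF gh(2)])
  note e = e0[rule_format]
  define Q where "Q = (\<lambda>N w. \<Sum>n<N. (c n + (w - m) * e n) * B w ^ n)"
  have holQ: "Q N holomorphic_on X" for N X
    unfolding Q_def by (intro holomorphic_intros holB)
  have rem: "1 / (2 * of_real pi * \<i>) *
       contour_integral \<Gamma>\<^sub>1 (\<lambda>w. f w / ((w - z\<^sub>1) ^ N * (w - z\<^sub>2) ^ N * (w - z))) *
       ((z - z\<^sub>1) ^ N * (z - z\<^sub>2) ^ N) = f\<^sub>1 z - Q N z" for N
  proof -
    obtain kg where kg: "kg holomorphic_on ball 0 \<rho>"
      "\<And>u. u \<in> ball 0 \<rho> \<Longrightarrow> g u = (\<Sum>n<N. c n * u ^ n) + u ^ N * kg u"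
      using c(2)[of N] by blast
    obtain kh where kh: "kh holomorphic_on ball 0 \<rho>"
      "\<And>u. u \<in> ball 0 \<rho> \<Longrightarrow> h u = (\<Sum>n<N. e n * u ^ n) + u ^ N * kh u"
      using e(2)[of N] by blast
    have comp: "(\<lambda>w. k (B w)) holomorphic_on ?L" if "k holomorphic_on ball 0 \<rho>" for k
      by (rule holomorphic_on_compose_gen[unfolded o_def, OF holB that]) auto
    obtain H where H: "H holomorphic_on \<Omega>" "\<forall>w \<in> \<Omega>. f\<^sub>1 w - Q N w = B w ^ N * H w"
    proof (rule holomorphic_quotient_glue[OF opn openL L(1),
          of "\<lambda>w. f\<^sub>1 w - Q N w" "\<lambda>w. B w ^ N" "\<lambda>w. kg (B w) + (w - m) * kh (B w)"])
      show "(\<lambda>w. f\<^sub>1 w - Q N w) holomorphic_on \<Omega>" "(\<lambda>w. B w ^ N) holomorphic_on \<Omega>"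
        by (intro holomorphic_intros f1 holQ holB)+
      show "(\<lambda>w. kg (B w) + (w - m) * kh (B w)) holomorphic_on ?L"
        by (intro holomorphic_intros comp kg(1) kh(1))
      fix w assume "w \<in> ?L"
      then have w: "B w \<in> ball 0 \<rho>" "cmod (B w) < \<rho>" by auto
      have "Q N w = (\<Sum>n<N. c n * B w ^ n) + (w - m) * (\<Sum>n<N. e n * B w ^ n)"
        by (simp add: Q_def sum.distrib sum_distrib_left distrib_right mult.assoc)
      then show "f\<^sub>1 w - Q N w = B w ^ N * (kg (B w) + (w - m) * kh (B w))"
        unfolding dec[OF w(2)] kg(2)[OF w(1)] kh(2)[OF w(1)] by (simp only: distrib_left) (simp add: mult_ac)
    next
      fix w assume "w \<in> \<Omega> - ?L"
      then have "\<not> cmod (B w) < \<rho>" by simp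
      moreover have "\<rho> > 0" using L(2) norm_ge_zero[of "B z"] by (simp only: mem_Collect_eq)
      ultimately show "B w ^ N \<noteq> 0" by auto
    qed (use that in blast)
    define G where "G = (\<lambda>w. (Q N w + f\<^sub>2 w) / B w ^ N / (w - z))"
    let ?S = "- \<Omega>\<^sub>0 - {z, z\<^sub>2}"
    have openS: "open ?S" using closed by (intro open_Diff open_Compl) auto
    have holG: "G holomorphic_on ?S"
      unfolding G_def
    proof (intro holomorphic_on_divide holomorphic_on_add holQ holomorphic_on_power holB holomorphic_on_diff
        holomorphic_on_ident holomorphic_on_const holomorphic_on_subset[OF f2])
      show "B w ^ N \<noteq> 0" if "w \<in> ?S" for w using that z1 by (auto simp: B_def)
    qed auto
    have R: "((\<lambda>w. 1 / B w) \<longlongrightarrow> 0) at_infinity"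
    proof -
      have "((\<lambda>w. 1 / (w - z\<^sub>1) * (1 / (w - z\<^sub>2))) \<longlongrightarrow> 0 * 0) at_infinity"
        by (intro tendsto_intros tendsto_inverse_diff_at_infinity)
      then show ?thesis by (simp add: B_def)
    qed
    have R1: "((\<lambda>w. (w - m) / B w) \<longlongrightarrow> 0) at_infinity"
    proof -
      have "((\<lambda>w. (w - m) / (w - z\<^sub>1) * (1 / (w - z\<^sub>2))) \<longlongrightarrow> 1 * 0) at_infinity"
        by (intro tendsto_intros tendsto_inverse_diff_at_infinity tendsto_quotient_diff_at_infinity)
      then show ?thesis by (simp add: B_def)
    qed
    have Bnz: "eventually (\<lambda>w. B w \<noteq> 0) at_infinity"
      using eventually_not_equal_at_infinity[of z\<^sub>1] eventually_not_equal_at_infinity[of z\<^sub>2]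
      by eventually_elim (auto simp: B_def)
    have "((\<lambda>w. (w - 0) / (w - z) *
        ((\<Sum>n<N. (c n * (1 / B w) + (w - m) / B w * e n) * (1 / B w) ^ (N - Suc n)) + f\<^sub>2 w * (1 / B w) ^ N))
        \<longlongrightarrow> 1 * ((\<Sum>n<N. (c n * 0 + 0 * e n) * 0 ^ (N - Suc n)) + 0 * 0 ^ N)) at_infinity"
      by (intro tendsto_intros R R1 lim tendsto_quotient_diff_at_infinity)
    moreover have "eventually (\<lambda>w. (w - 0) / (w - z) *
        ((\<Sum>n<N. (c n * (1 / B w) + (w - m) / B w * e n) * (1 / B w) ^ (N - Suc n)) + f\<^sub>2 w * (1 / B w) ^ N)
        = w * G w) at_infinity"
      using Bnz
    proof eventually_elim
      case (elim w)
      have "(c n * (1 / B w) + (w - m) / B w * e n) * (1 / B w) ^ (N - Suc n)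
          = (c n + (w - m) * e n) * B w ^ n / B w ^ N" if "n < N" for n
      proof -
        have "B w ^ N = B w ^ n * B w ^ Suc (N - Suc n)"
          using that by (metis Suc_diff_Suc add_diff_inverse_nat less_not_sym power_add)
        then show ?thesis using elim by (simp add: field_simps)
      qed
      then have S: "(\<Sum>n<N. (c n * (1 / B w) + (w - m) / B w * e n) * (1 / B w) ^ (N - Suc n)) = Q N w / B w ^ N"
        unfolding Q_def sum_divide_distrib by (intro sum.cong) auto
      show ?case unfolding S by (simp add: G_def power_one_over add_divide_distrib distrib_left mult_ac)
    qed
    ultimately have limG: "((\<lambda>w. w * G w) \<longlongrightarrow> 0) at_infinity"
      by (simp add: tendsto_cong)
    have outS: "path_image \<Gamma>\<^sub>1 \<union> outside (path_image \<Gamma>\<^sub>1) \<subseteq> ?S"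
      using core_inside(1) points(1,2) union_with_outside[of "path_image \<Gamma>\<^sub>1"] by blast
    have "contour_integral \<Gamma>\<^sub>1 G = 0"
      using contour_integral_limit_at_infinity[OF loops(1) openS outS holG limG] by simp
    moreover have "G contour_integrable_on \<Gamma>\<^sub>1"
      by (rule contour_integrable_holomorphic_simple[OF holG openS]) (use ccw_loopD[OF loops(1)] outS in auto)
    ultimately have iG: "(G has_contour_integral 0) \<Gamma>\<^sub>1"
      by (metis has_contour_integral_integral)
    have iH: "((\<lambda>w. H w / (w - z)) has_contour_integral (2 * pi * \<i> * winding_number \<Gamma>\<^sub>1 z * H z)) \<Gamma>\<^sub>1"
    proof (rule Cauchy_integral_formula_global[OF opn H(1)])
      fix w assume "w \<notin> \<Omega>"
      then have "w \<in> outside (path_image \<Gamma>\<^sub>1)"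
        using inside_domain images(1) inside_Un_outside[of "path_image \<Gamma>\<^sub>1"] by blast
      then show "winding_number \<Gamma>\<^sub>1 w = 0" by (rule ccw_loopD(9)[OF loops(1)])
    qed (use z images(1) off_contours(1) ccw_loopD[OF loops(1)] in auto)
    have "((\<lambda>w. H w / (w - z) + G w) has_contour_integral (2 * of_real pi * \<i> * H z)) \<Gamma>\<^sub>1"
      using has_contour_integral_add[OF iH iG] ccw_loopD(8)[OF loops(1) points(1)] by simp
    then have "((\<lambda>w. f w / ((w - z\<^sub>1) ^ N * (w - z\<^sub>2) ^ N * (w - z))) has_contour_integral
        (2 * of_real pi * \<i> * H z)) \<Gamma>\<^sub>1"
    proof (rule has_contour_integral_eq)
      fix w assume w: "w \<in> path_image \<Gamma>\<^sub>1"
      then have w': "w \<in> \<Omega> - \<Omega>\<^sub>0" "B w \<noteq> 0" using images off_contours by (auto simp: B_def)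
      have "H w = (f\<^sub>1 w - Q N w) / B w ^ N" using H(2)[rule_format, of w] w' by simp
      then have H': "H w + (Q N w + f\<^sub>2 w) / B w ^ N = f w / B w ^ N"
        using split[of w] w' by (simp add: add_divide_distrib[symmetric])
      have "H w / (w - z) + G w = (H w + (Q N w + f\<^sub>2 w) / B w ^ N) / (w - z)"
        unfolding G_def by (rule add_divide_distrib[symmetric])
      also have "\<dots> = f w / ((w - z\<^sub>1) ^ N * (w - z\<^sub>2) ^ N * (w - z))"
        unfolding H' by (simp add: B_def power_mult_distrib)
      finally show "H w / (w - z) + G w = f w / ((w - z\<^sub>1) ^ N * (w - z\<^sub>2) ^ N * (w - z))" .
    qed
    then have "contour_integral \<Gamma>\<^sub>1 (\<lambda>w. f w / ((w - z\<^sub>1) ^ N * (w - z\<^sub>2) ^ N * (w - z)))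
        = 2 * of_real pi * \<i> * H z" by (rule contour_integral_unique)
    then show ?thesis using H(2)[rule_format, of z] z by (simp add: B_def power_mult_distrib mult_ac)
  qed
  have z': "B z \<in> ball 0 \<rho>" "cmod (B z) < \<rho>" using L(2) by auto
  have "(\<lambda>N. Q N z) = (\<lambda>N. (\<Sum>n<N. c n * B z ^ n) + (z - m) * (\<Sum>n<N. e n * B z ^ n))"
    by (simp add: Q_def sum.distrib sum_distrib_left distrib_right mult.assoc)
  also have "\<dots> \<longlonglongrightarrow> g (B z) + (z - m) * h (B z)"
    using c(1)[OF z'(1)] e(1)[OF z'(1)] unfolding sums_def by (intro tendsto_intros)
  finally have "(\<lambda>N. Q N z) \<longlonglongrightarrow> f\<^sub>1 z" unfolding dec[OF z'(2)] .
  then show ?thesis unfolding rem using tendsto_diff[OF tendsto_const, of _ "f\<^sub>1 z" _ "f\<^sub>1 z"] by fastforce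
qed

text \<open>
  With \<open>f\<^sub>2 = P N + p ^ N * H\<close>, the integrand is \<open>H w / (w - z)\<close>, whose integral is given by Cauchy's
  formula for the exterior, plus \<open>(P N w + f\<^sub>1 w) / p w ^ N / (w - z)\<close>. The pole of \<open>p\<close> at \<open>z\<^sub>1\<close>
  absorbs the poles of \<open>P N\<close>, so the latter is holomorphic inside the contour and has integral \<open>0\<close>.
  The remainder is therefore \<open>P N z - f\<^sub>2 z\<close>.
\<close>

lemma quotient_remainder_tendsto_0:
  assumes f1: "f\<^sub>1 holomorphic_on \<Omega>" and f2: "f\<^sub>2 holomorphic_on - \<Omega>\<^sub>0"
    and split: "\<And>w. w \<in> \<Omega> - \<Omega>\<^sub>0 \<Longrightarrow> f w = f\<^sub>1 w + f\<^sub>2 w"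
    and lim: "((\<lambda>w. w * f\<^sub>2 w) \<longlongrightarrow> a) at_infinity" "(f\<^sub>2 \<longlongrightarrow> 0) at_infinity"
    and \<sigma>: "\<And>w. w \<noteq> z\<^sub>1 \<Longrightarrow> cmod ((w - z\<^sub>2) / (w - z\<^sub>1)) < \<sigma> \<Longrightarrow> w \<notin> \<Omega>\<^sub>0"
      "cmod ((z - z\<^sub>2) / (z - z\<^sub>1)) < \<sigma>"
  shows "(\<lambda>N. 1 / (2 * of_real pi * \<i>) *
       contour_integral \<Gamma>\<^sub>2 (\<lambda>w. (w - z\<^sub>1) ^ N * f w / ((w - z\<^sub>2) ^ N * (w - z))) *
       ((z - z\<^sub>2) ^ N / (z - z\<^sub>1) ^ N)) \<longlonglongrightarrow> 0"
proof -
  define p where "p = (\<lambda>w. (w - z\<^sub>2) / (w - z\<^sub>1))"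
  have \<sigma>0: "\<sigma> > 0" using \<sigma>(2) norm_ge_zero order_le_less_trans by blast
  let ?L = "{w \<in> - {z\<^sub>1}. cmod (p w) < \<sigma>}"
  have holp: "p holomorphic_on X" if "z\<^sub>1 \<notin> X" for X
    unfolding p_def using that by (intro holomorphic_intros) auto
  have L: "?L \<subseteq> - \<Omega>\<^sub>0" "z \<in> ?L" using \<sigma> distinct by (auto simp: p_def)
  have "open (- {z\<^sub>1} \<inter> p -` ball 0 \<sigma>)"
    by (rule continuous_open_preimage) (auto intro!: holomorphic_on_imp_continuous_on holp)
  also have "- {z\<^sub>1} \<inter> p -` ball 0 \<sigma> = ?L" by auto
  finally have openL: "open ?L" .
  have openC: "open (- \<Omega>\<^sub>0)" using closed by (rule open_Compl)
  obtain \<psi> where \<psi>: "\<psi> holomorphic_on ball 0 \<sigma>"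
    "\<forall>w. w \<noteq> z\<^sub>1 \<longrightarrow> (w - z\<^sub>1) * f\<^sub>2 w = \<psi> (p w)"
    unfolding p_def
    by (rule exterior_quotient_expansion[OF f2 z1 distinct(2) lim(1) \<sigma>(1)])
  obtain c where c0: "\<forall>u \<in> ball 0 \<sigma>. (\<lambda>n. c n * u ^ n) sums \<psi> u"
    "\<forall>N. \<exists>k. k holomorphic_on ball 0 \<sigma> \<and> (\<forall>u \<in> ball 0 \<sigma>. \<psi> u = (\<Sum>n<N. c n * u ^ n) + u ^ N * k u)"
    by (rule holomorphic_Taylor_tails[OF \<psi>(1)])
  note c = c0[rule_format]
  define P where "P = (\<lambda>N w. (\<Sum>n<N. c n * p w ^ n) / (w - z\<^sub>1))"
  have holP: "P N holomorphic_on X" if "z\<^sub>1 \<notin> X" for N X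
    unfolding P_def using that by (intro holomorphic_intros holp) auto
  have rem: "1 / (2 * of_real pi * \<i>) *
       contour_integral \<Gamma>\<^sub>2 (\<lambda>w. (w - z\<^sub>1) ^ N * f w / ((w - z\<^sub>2) ^ N * (w - z))) *
       ((z - z\<^sub>2) ^ N / (z - z\<^sub>1) ^ N) = P N z - f\<^sub>2 z" for N
  proof -
    obtain k where k: "k holomorphic_on ball 0 \<sigma>"
      "\<And>u. u \<in> ball 0 \<sigma> \<Longrightarrow> \<psi> u = (\<Sum>n<N. c n * u ^ n) + u ^ N * k u"
      using c(2)[of N] by blast
    obtain H where H: "H holomorphic_on - \<Omega>\<^sub>0" "\<forall>w \<in> - \<Omega>\<^sub>0. f\<^sub>2 w - P N w = p w ^ N * H w"
    proof (rule holomorphic_quotient_glue[OF openC openL L(1),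
          of "\<lambda>w. f\<^sub>2 w - P N w" "\<lambda>w. p w ^ N" "\<lambda>w. k (p w) / (w - z\<^sub>1)"])
      show "(\<lambda>w. f\<^sub>2 w - P N w) holomorphic_on - \<Omega>\<^sub>0" "(\<lambda>w. p w ^ N) holomorphic_on - \<Omega>\<^sub>0"
        using z1 by (intro holomorphic_intros f2 holP holp; simp)+
      show "(\<lambda>w. k (p w) / (w - z\<^sub>1)) holomorphic_on ?L"
        by (intro holomorphic_on_divide holomorphic_on_compose_gen[unfolded o_def, OF holp k(1)]
            holomorphic_intros) auto
      fix w assume "w \<in> ?L"
      then have w: "p w \<in> ball 0 \<sigma>" "cmod (p w) < \<sigma>" "w \<noteq> z\<^sub>1" by auto
      have "f\<^sub>2 w = \<psi> (p w) / (w - z\<^sub>1)" using \<psi>(2)[rule_format, OF w(3)] w(3) by (simp add: field_simps)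
      then show "f\<^sub>2 w - P N w = p w ^ N * (k (p w) / (w - z\<^sub>1))"
        unfolding k(2)[OF w(1)] by (simp add: P_def add_divide_distrib)
    next
      fix w assume "w \<in> - \<Omega>\<^sub>0 - ?L"
      then have "\<not> cmod (p w) < \<sigma>" using z1 by auto
      then show "p w ^ N \<noteq> 0" using \<sigma>0 by auto
    qed (use that in blast)
    have ev: "eventually (\<lambda>w. w \<noteq> z\<^sub>1 \<and> w \<noteq> z\<^sub>2 \<and> w \<in> - \<Omega>\<^sub>0) at_infinity"
    proof -
      have "bounded \<Omega>\<^sub>0"
        using bounded_subset[OF bounded_inside[OF compact_imp_bounded[OF ccw_loopD(4)[OF loops(1)]]] core_inside(1)] .
      then obtain r where "\<Omega>\<^sub>0 \<subseteq> ball 0 r" using bounded_subset_ballD by blast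
      then have "\<forall>w. cmod w \<ge> r \<longrightarrow> w \<in> - \<Omega>\<^sub>0" by (auto simp: subset_iff not_less[symmetric])
      then have "eventually (\<lambda>w. w \<in> - \<Omega>\<^sub>0) at_infinity" unfolding eventually_at_infinity by blast
      then show ?thesis
        using eventually_not_equal_at_infinity[of z\<^sub>1] eventually_not_equal_at_infinity[of z\<^sub>2]
        by eventually_elim auto
    qed
    have "((\<lambda>w. (f\<^sub>2 w - (\<Sum>n<N. c n * p w ^ n) * (1 / (w - z\<^sub>1))) * ((w - z\<^sub>1) / (w - z\<^sub>2)) ^ N) \<longlongrightarrow>
        (0 - (\<Sum>n<N. c n * 1 ^ n) * 0) * 1 ^ N) at_infinity"
      unfolding p_def
      by (intro tendsto_intros lim(2) tendsto_inverse_diff_at_infinity tendsto_quotient_diff_at_infinity)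
    moreover have "eventually (\<lambda>w. (f\<^sub>2 w - (\<Sum>n<N. c n * p w ^ n) * (1 / (w - z\<^sub>1))) *
        ((w - z\<^sub>1) / (w - z\<^sub>2)) ^ N = H w) at_infinity"
      using ev
    proof eventually_elim
      case (elim w)
      then have "f\<^sub>2 w - (\<Sum>n<N. c n * p w ^ n) * (1 / (w - z\<^sub>1)) = p w ^ N * H w"
        using H(2)[rule_format, of w] by (simp add: P_def)
      moreover have "p w ^ N * ((w - z\<^sub>1) / (w - z\<^sub>2)) ^ N = 1"
        using elim by (simp add: p_def power_mult_distrib[symmetric])
      ultimately show ?case by (metis mult.commute mult.left_commute mult.right_neutral)
    qed
    ultimately have limH: "(H \<longlongrightarrow> 0) at_infinity" by (simp add: tendsto_cong)
    have iH: "contour_integral \<Gamma>\<^sub>2 (\<lambda>w. H w / (w - z)) = - (2 * of_real pi * \<i> * H z)"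
      by (rule Cauchy_integral_formula_exterior[OF loops(2) openC _ H(1) limH points(3)])
         (use core_inside(2) union_with_outside[of "path_image \<Gamma>\<^sub>2"] in blast)
    have "(\<lambda>w. H w / (w - z)) contour_integrable_on \<Gamma>\<^sub>2"
    proof (rule integrable(2))
      show "(\<lambda>w. H w / (w - z)) holomorphic_on \<Omega> - \<Omega>\<^sub>0 - {z, z\<^sub>2}"
        by (intro holomorphic_intros holomorphic_on_subset[OF H(1)]) auto
    qed
    then have iH': "((\<lambda>w. H w / (w - z)) has_contour_integral - (2 * of_real pi * \<i> * H z)) \<Gamma>\<^sub>2"
      using iH by (metis has_contour_integral_integral)
    \<comment> \<open>\<open>(P N w + f\<^sub>1 w) / p w ^ N / (w - z)\<close> with the powers of \<open>w - z\<^sub>1\<close> cancelled, so that it is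
        holomorphic at \<open>z\<^sub>1\<close>.\<close>
    define G where "G = (\<lambda>w. ((\<Sum>n<N. c n * ((w - z\<^sub>1) ^ (N - Suc n) / (w - z\<^sub>2) ^ (N - n)))
        + f\<^sub>1 w * ((w - z\<^sub>1) ^ N / (w - z\<^sub>2) ^ N)) / (w - z))"
    have iG: "(G has_contour_integral 0) \<Gamma>\<^sub>2"
    proof (rule Cauchy_theorem_global)
      show "open (\<Omega> - {z, z\<^sub>2})" using opn by (intro open_Diff) auto
      show "G holomorphic_on \<Omega> - {z, z\<^sub>2}"
        unfolding G_def by (intro holomorphic_intros holomorphic_on_subset[OF f1]) auto
      show "path_image \<Gamma>\<^sub>2 \<subseteq> \<Omega> - {z, z\<^sub>2}" using images off_contours by auto
      show "winding_number \<Gamma>\<^sub>2 w = 0" if "w \<notin> \<Omega> - {z, z\<^sub>2}" for w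
        using that points inside_domain outer_subset by (intro ccw_loopD(9)[OF loops(2)]) auto
    qed (use ccw_loopD[OF loops(2)] in auto)
    have "((\<lambda>w. H w / (w - z) + G w) has_contour_integral - (2 * of_real pi * \<i> * H z)) \<Gamma>\<^sub>2"
      using has_contour_integral_add[OF iH' iG] by simp
    then have "((\<lambda>w. (w - z\<^sub>1) ^ N * f w / ((w - z\<^sub>2) ^ N * (w - z))) has_contour_integral
        - (2 * of_real pi * \<i> * H z)) \<Gamma>\<^sub>2"
    proof (rule has_contour_integral_eq)
      fix w assume w: "w \<in> path_image \<Gamma>\<^sub>2"
      then have w': "w \<in> \<Omega> - \<Omega>\<^sub>0" "w - z\<^sub>1 \<noteq> 0" "w - z\<^sub>2 \<noteq> 0" using images off_contours by auto
      have pN: "p w ^ N * ((w - z\<^sub>1) ^ N / (w - z\<^sub>2) ^ N) = 1"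
        using w' by (simp add: p_def power_divide)
      have "P N w * ((w - z\<^sub>1) ^ N / (w - z\<^sub>2) ^ N)
          = (\<Sum>n<N. c n * ((w - z\<^sub>1) ^ (N - Suc n) / (w - z\<^sub>2) ^ (N - n)))"
        unfolding P_def sum_divide_distrib sum_distrib_right
      proof (rule sum.cong)
        fix n assume "n \<in> {..<N}"
        then have "N = n + (N - n)" "N = n + Suc (N - Suc n)" by auto
        then have "(w - z\<^sub>1) ^ N = (w - z\<^sub>1) ^ n * ((w - z\<^sub>1) * (w - z\<^sub>1) ^ (N - Suc n))"
          "(w - z\<^sub>2) ^ N = (w - z\<^sub>2) ^ n * (w - z\<^sub>2) ^ (N - n)"
          by (metis power_add power_Suc)+
        then show "c n * p w ^ n / (w - z\<^sub>1) * ((w - z\<^sub>1) ^ N / (w - z\<^sub>2) ^ N)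
          = c n * ((w - z\<^sub>1) ^ (N - Suc n) / (w - z\<^sub>2) ^ (N - n))"
          using w' by (simp add: p_def power_divide)
      qed simp
      moreover have "H w = (f\<^sub>2 w - P N w) * ((w - z\<^sub>1) ^ N / (w - z\<^sub>2) ^ N)"
        using H(2)[rule_format, of w] w' pN by (metis ComplI DiffD2 mult.commute mult.left_commute mult.right_neutral)
      moreover define \<kappa> where "\<kappa> = (w - z\<^sub>1) ^ N / (w - z\<^sub>2) ^ N"
      ultimately have "H w + ((\<Sum>n<N. c n * ((w - z\<^sub>1) ^ (N - Suc n) / (w - z\<^sub>2) ^ (N - n)))
        + f\<^sub>1 w * ((w - z\<^sub>1) ^ N / (w - z\<^sub>2) ^ N)) = f w * ((w - z\<^sub>1) ^ N / (w - z\<^sub>2) ^ N)"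
        unfolding split[OF w'(1)] \<kappa>_def[symmetric] by (simp only: left_diff_distrib distrib_right) simp
      then show "H w / (w - z) + G w = (w - z\<^sub>1) ^ N * f w / ((w - z\<^sub>2) ^ N * (w - z))"
        by (simp add: G_def add_divide_distrib[symmetric] mult.commute)
    qed
    then have "contour_integral \<Gamma>\<^sub>2 (\<lambda>w. (w - z\<^sub>1) ^ N * f w / ((w - z\<^sub>2) ^ N * (w - z)))
        = - (2 * of_real pi * \<i> * H z)" by (rule contour_integral_unique)
    moreover have "(z - z\<^sub>2) ^ N / (z - z\<^sub>1) ^ N * H z = f\<^sub>2 z - P N z"
      using H(2)[rule_format, of z] z by (simp add: p_def power_divide)
    ultimately show ?thesis by (simp add: mult_ac)
  qed
  have z': "p z \<in> ball 0 \<sigma>" "cmod (p z) < \<sigma>" using L(2) by auto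
  have "(\<lambda>N. P N z) \<longlonglongrightarrow> \<psi> (p z) / (z - z\<^sub>1)"
    unfolding P_def using c(1)[OF z'(1)] distinct unfolding sums_def by (intro tendsto_intros) auto
  also have "\<psi> (p z) / (z - z\<^sub>1) = f\<^sub>2 z"
    using \<psi>(2)[rule_format, OF distinct(1)] distinct by (simp add: field_simps)
  finally have "(\<lambda>N. P N z) \<longlonglongrightarrow> f\<^sub>2 z" .
  then show ?thesis unfolding rem by (rule LIM_zero)
qed

text \<open>
  The strict inequalities that define the region leave room for radii \<open>\<rho>\<close> and \<open>\<sigma>\<close> strictly between,
  which are real even when \<open>radius1\<close> or \<open>radius2\<close> is infinite.
\<close>

theorem remainder_tendsto_0:
  assumes "z \<in> region_D \<Omega> \<Omega>\<^sub>0 z\<^sub>1 z\<^sub>2"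
  shows "(\<lambda>N. remainder f \<Gamma>\<^sub>1 \<Gamma>\<^sub>2 N z\<^sub>1 z\<^sub>2 z) \<longlonglongrightarrow> 0"
proof -
  have r1: "ereal (cmod ((z - z\<^sub>1) * (z - z\<^sub>2))) < radius1 \<Omega> z\<^sub>1 z\<^sub>2"
    and r2: "ereal (cmod (z - z\<^sub>2)) < radius2 \<Omega>\<^sub>0 z\<^sub>1 z\<^sub>2 * ereal (cmod (z - z\<^sub>1))"
    using assms by (auto simp: region_D_def)
  obtain \<rho> where \<rho>: "cmod ((z - z\<^sub>1) * (z - z\<^sub>2)) < \<rho>" "ereal \<rho> < radius1 \<Omega> z\<^sub>1 z\<^sub>2"
    using ereal_dense2[OF r1] by auto
  have L1: "{w. cmod ((w - z\<^sub>1) * (w - z\<^sub>2)) < \<rho>} \<subseteq> \<Omega>"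
  proof (rule ccontr)
    assume "\<not> ?thesis"
    then obtain w where w: "cmod ((w - z\<^sub>1) * (w - z\<^sub>2)) < \<rho>" "w \<in> UNIV - \<Omega>" by auto
    have "radius1 \<Omega> z\<^sub>1 z\<^sub>2 \<le> ereal (cmod ((w - z\<^sub>1) * (w - z\<^sub>2)))"
      unfolding radius1_def using w(2) by (rule INF_lower)
    also have "\<dots> < ereal \<rho>" using w(1) by simp
    finally show False using \<rho>(2) by simp
  qed
  have "cmod (z - z\<^sub>1) > 0" using distinct by simp
  then have "ereal (cmod ((z - z\<^sub>2) / (z - z\<^sub>1))) < radius2 \<Omega>\<^sub>0 z\<^sub>1 z\<^sub>2"
    using r2 by (cases "radius2 \<Omega>\<^sub>0 z\<^sub>1 z\<^sub>2") (auto simp: norm_divide divide_less_eq)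
  then obtain \<sigma> where \<sigma>: "cmod ((z - z\<^sub>2) / (z - z\<^sub>1)) < \<sigma>" "ereal \<sigma> < radius2 \<Omega>\<^sub>0 z\<^sub>1 z\<^sub>2"
    using ereal_dense2 by force
  have L2: "w \<notin> \<Omega>\<^sub>0" if w: "w \<noteq> z\<^sub>1" "cmod ((w - z\<^sub>2) / (w - z\<^sub>1)) < \<sigma>" for w
  proof
    assume "w \<in> \<Omega>\<^sub>0"
    then have "radius2 \<Omega>\<^sub>0 z\<^sub>1 z\<^sub>2 \<le> (if w = z\<^sub>1 then \<infinity> else ereal (cmod ((w - z\<^sub>2) * inverse (w - z\<^sub>1))))"
      unfolding radius2_def by (rule INF_lower)
    also have "\<dots> < ereal \<sigma>" using w by (simp add: divide_inverse)
    finally show False using \<sigma>(2) by simp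
  qed
  obtain f\<^sub>1 f\<^sub>2 c where f: "f\<^sub>1 holomorphic_on \<Omega>" "f\<^sub>2 holomorphic_on - \<Omega>\<^sub>0"
    "\<And>w. w \<in> \<Omega> - \<Omega>\<^sub>0 \<Longrightarrow> f w = f\<^sub>1 w + f\<^sub>2 w" and lim: "((\<lambda>w. w * f\<^sub>2 w) \<longlongrightarrow> c) at_infinity"
    using Laurent_split by blast
  have "((\<lambda>w. 1 / (w - 0) * (w * f\<^sub>2 w)) \<longlongrightarrow> 0 * c) at_infinity"
    by (intro tendsto_intros lim tendsto_inverse_diff_at_infinity)
  moreover have "eventually (\<lambda>w. 1 / (w - 0) * (w * f\<^sub>2 w) = f\<^sub>2 w) at_infinity"
    by (rule eventually_mono[OF eventually_not_equal_at_infinity[of 0]]) simp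
  ultimately have lim0: "(f\<^sub>2 \<longlongrightarrow> 0) at_infinity" by (simp add: tendsto_cong)
  show ?thesis
    unfolding remainder_def
    using tendsto_diff[OF lemniscate_remainder_tendsto_0[OF f lim0 L1 \<rho>(1)]
        quotient_remainder_tendsto_0[OF f lim lim0 L2 \<sigma>(1)]] by simp
qed

end

theorem theorem3:
  fixes \<Omega> \<Omega>\<^sub>0 :: "complex set" and f :: "complex \<Rightarrow> complex" and z\<^sub>1 z\<^sub>2 :: complex
  assumes "closed \<Omega>\<^sub>0" and "open \<Omega>" and "\<Omega>\<^sub>0 \<subseteq> \<Omega>"
    and "f analytic_on (\<Omega> - \<Omega>\<^sub>0)"
    and "z\<^sub>1 \<in> \<Omega>\<^sub>0" and "z\<^sub>2 \<in> \<Omega> - \<Omega>\<^sub>0"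
  shows
    "(\<forall>z \<in> \<Omega> - \<Omega>\<^sub>0. \<forall>\<Gamma>\<^sub>1 \<Gamma>\<^sub>2. admissible_contours \<Omega> \<Omega>\<^sub>0 z\<^sub>2 z \<Gamma>\<^sub>1 \<Gamma>\<^sub>2 \<longrightarrow>
        (\<forall>N::nat. N > 0 \<longrightarrow>
          f z =
            (\<Sum>n<N. (coeff_d f \<Gamma>\<^sub>1 n z\<^sub>1 z\<^sub>2 * (z - z\<^sub>1) + coeff_d f \<Gamma>\<^sub>1 n z\<^sub>2 z\<^sub>1 * (z - z\<^sub>2)) *
                     (z - z\<^sub>1) ^ n * (z - z\<^sub>2) ^ n) +
            (\<Sum>n<N. coeff_e f \<Gamma>\<^sub>2 n z\<^sub>1 z\<^sub>2 * (z - z\<^sub>2) ^ n / (z - z\<^sub>1) ^ (n + 1)) +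
            remainder f \<Gamma>\<^sub>1 \<Gamma>\<^sub>2 N z\<^sub>1 z\<^sub>2 z)) \<and>
     (\<forall>z \<in> region_D \<Omega> \<Omega>\<^sub>0 z\<^sub>1 z\<^sub>2. \<forall>\<Gamma>\<^sub>1 \<Gamma>\<^sub>2. admissible_contours \<Omega> \<Omega>\<^sub>0 z\<^sub>2 z \<Gamma>\<^sub>1 \<Gamma>\<^sub>2 \<longrightarrow>
        (\<lambda>N. remainder f \<Gamma>\<^sub>1 \<Gamma>\<^sub>2 N z\<^sub>1 z\<^sub>2 z) \<longlonglongrightarrow> 0)"
proof -
  have loc: "annular_expansion \<Omega> \<Omega>\<^sub>0 f z\<^sub>1 z\<^sub>2 z \<Gamma>\<^sub>1 \<Gamma>\<^sub>2"
    if "z \<in> \<Omega> - \<Omega>\<^sub>0" "admissible_contours \<Omega> \<Omega>\<^sub>0 z\<^sub>2 z \<Gamma>\<^sub>1 \<Gamma>\<^sub>2" for z \<Gamma>\<^sub>1 \<Gamma>\<^sub>2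
    using assms that by unfold_locales (auto intro: analytic_imp_holomorphic)
  show ?thesis
  proof (intro conjI ballI allI impI)
    fix z \<Gamma>\<^sub>1 \<Gamma>\<^sub>2
    assume z: "z \<in> region_D \<Omega> \<Omega>\<^sub>0 z\<^sub>1 z\<^sub>2" and adm: "admissible_contours \<Omega> \<Omega>\<^sub>0 z\<^sub>2 z \<Gamma>\<^sub>1 \<Gamma>\<^sub>2"
    have "z \<in> \<Omega> - \<Omega>\<^sub>0" using z by (simp add: region_D_def)
    then show "(\<lambda>N. remainder f \<Gamma>\<^sub>1 \<Gamma>\<^sub>2 N z\<^sub>1 z\<^sub>2 z) \<longlonglongrightarrow> 0"
      using annular_expansion.remainder_tendsto_0[OF loc z] adm by blast
  qed (rule annular_expansion.expansion[OF loc])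
qed

end
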